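(* Let $G=(V,E)$ be a connected and locally finite weighted graph with a measure $\sigma$ satisfying $\sigma(x)\ge\sigma_0>0$ for all $x\in V$ and some constant $\sigma_0$. Let $p>1$ and let $\rho:V\to[0,+\infty)$ satisfy $\rho(x)\to+\infty$ as $d(x)\to+\infty$. Suppose that $\psi:V\times[0,+\infty)\to\mathbb{R}$, with primitive $\Psi(x,s)=\int_0^s\psi(x,t)\,dt$, satisfies: (i) $\psi(x,0)=0$ for every $x\in V$, $\psi(x,s)$ is continuous in $s\in[0,+\infty)$, and for every $M>0$ there is a constant $A_M$ such that $\psi(x,s)\le A_M$ for all $(x,s)\in V\times[0,M]$; (ii) there is a constant $\alpha>p$ such that $0<\alpha\Psi(x,s)\le s\psi(x,s)$ for all $s>0$ and $x\in V$; (iii) $\limsup_{s\to0+}\psi(x,s)/s^{p-1}<\lambda_p$ uniformly in $x\in V$. Then the equation $$-\Delta_p u+\rho|u|^{p-2}u=\psi(x,u^+)\quad\text{in }V$$ has a strictly positive solution $u\in\mathcal{H}_p(V)$ (that is, the equation holds at every $x\in V$, and $u(x)>0$ for all $x\in V$).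
   Context: $G=(V,E)$ is a graph with vertex set $V$ and edge set $E$; $y\sim x$ means $xy\in E$; locally finite means every vertex has finitely many neighbours. Each edge has a weight $w_{xy}=w_{yx}>0$. $d(x)=dist(x,O)$ is the graph distance from $x$ to a fixed vertex $O\in V$. For $u:V\to\mathbb{R}$, $u^+=\max\{u,0\}$ and $\int_V u\,d\sigma=\sum_{x\in V}\sigma(x)u(x)$; $\|u\|_p=(\int_V|u|^pd\sigma)^{1/p}$. Gradient: if $y_1,\dots,y_{\ell_x}$ are the neighbours of $x$, $\nabla u(x)=\big(\sqrt{w_{xy_i}/(2\sigma(x))}\,(u(y_i)-u(x))\big)_{i=1}^{\ell_x}\in\mathbb{R}^{\ell_x}$, and $|\nabla u|(x)=\big(\frac{1}{2\sigma(x)}\sum_{y\sim x}w_{xy}(u(y)-u(x))^2\big)^{1/2}$. $p$-Laplacian: $\Delta_pu(x)=\frac{1}{\sigma(x)}\sum_{y\sim x}\frac{|\nabla u|^{p-2}(x)+|\nabla u|^{p-2}(y)}{2}w_{xy}(u(y)-u(x))$. When $1<p<2$, terms with $u(y)=u(x)$ are read as $0$, and $|u|^{p-2}u$ is read as $0$ where $u=0$. $\mathcal{H}_p(V)$ is the completion of $C_c(V)$ (finitely supported functions on $V$) under the norm $\|u\|_{\mathcal{H}_p}=\big(\int_V(|\nabla u|^p+\rho|u|^p)d\sigma\big)^{1/p}$, regarded as a space of functions on $V$. $\lambda_p=\inf_{u\in\mathcal{H}_p(V),\,u\not\equiv0}\|u\|_{\mathcal{H}_p}^p/\|u\|_p^p$.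 In (iii), "uniformly" means there are $\tau<\lambda_p$ and $\delta>0$ with $\psi(x,s)\le\tau s^{p-1}$ for all $x\in V$, $0<s<\delta$. *)

theory Defs
  imports "HOL-Analysis.Analysis"
begin

text \<open>
  The vertex set is the type \<open>'v\<close>, and the edge set is a symmetric relation \<open>E\<close> on it, so the
  neighbours of \<open>x\<close> are \<open>E `` {x}\<close>. Loops are not excluded; they contribute nothing to any of the
  quantities below, since \<open>u x - u x = 0\<close>.
\<close>

text \<open>The length of a shortest path; only meaningful when \<open>y\<close> is reachable from \<open>x\<close>.\<close>

definition graph_dist :: "('v \<times> 'v) set \<Rightarrow> 'v \<Rightarrow> 'v \<Rightarrow> nat" where
  "graph_dist E x y = (LEAST n. (x, y) \<in> E ^^ n)"

definition vint :: "('v \<Rightarrow> real) \<Rightarrow> ('v \<Rightarrow> real) \<Rightarrow> real" where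
  "vint \<sigma> f = (\<Sum>\<^sub>\<infinity>x. \<sigma> x * f x)"

definition lp_norm :: "('v \<Rightarrow> real) \<Rightarrow> real \<Rightarrow> ('v \<Rightarrow> real) \<Rightarrow> real" where
  "lp_norm \<sigma> p u = vint \<sigma> (\<lambda>x. \<bar>u x\<bar> powr p) powr (1 / p)"

definition grad_norm ::
  "('v \<times> 'v) set \<Rightarrow> ('v \<Rightarrow> 'v \<Rightarrow> real) \<Rightarrow> ('v \<Rightarrow> real) \<Rightarrow> ('v \<Rightarrow> real) \<Rightarrow> 'v \<Rightarrow> real" where
  "grad_norm E w \<sigma> u x = sqrt (1 / (2 * \<sigma> x) * (\<Sum>y\<in>E `` {x}. w x y * (u y - u x)\<^sup>2))"

text \<open>
  Since \<open>0 powr a = 0\<close> for every \<open>a\<close>, all expressions below are total. If the gradient vanishes at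
  \<open>x\<close> or at a neighbour \<open>y\<close> of \<open>x\<close>, then \<open>u y = u x\<close> and the summand is \<open>0\<close>. This gives the
  reading of these terms as \<open>0\<close> for \<open>1 < p < 2\<close>, and the usual value for \<open>p \<ge> 2\<close> (including
  \<open>p = 2\<close>, although \<open>0 powr 0 = 0\<close>).
\<close>

definition p_laplacian ::
  "('v \<times> 'v) set \<Rightarrow> ('v \<Rightarrow> 'v \<Rightarrow> real) \<Rightarrow> ('v \<Rightarrow> real) \<Rightarrow> real \<Rightarrow> ('v \<Rightarrow> real) \<Rightarrow> 'v \<Rightarrow> real" where
  "p_laplacian E w \<sigma> p u x =
     1 / \<sigma> x * (\<Sum>y\<in>E `` {x}.
       (grad_norm E w \<sigma> u x powr (p - 2) + grad_norm E w \<sigma> u y powr (p - 2)) / 2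
         * w x y * (u y - u x))"

definition fin_supp :: "('v \<Rightarrow> real) set" where
  "fin_supp = {u. finite {x. u x \<noteq> 0}}"

definition Hp_norm ::
  "('v \<times> 'v) set \<Rightarrow> ('v \<Rightarrow> 'v \<Rightarrow> real) \<Rightarrow> ('v \<Rightarrow> real) \<Rightarrow> ('v \<Rightarrow> real) \<Rightarrow> real
    \<Rightarrow> ('v \<Rightarrow> real) \<Rightarrow> real" where
  "Hp_norm E w \<sigma> \<rho> p u =
     vint \<sigma> (\<lambda>x. grad_norm E w \<sigma> u x powr p + \<rho> x * \<bar>u x\<bar> powr p) powr (1 / p)"

text \<open>
  The completion of the finitely supported functions, realised as functions on the vertices: an
  element is represented by a Cauchy sequence for \<open>Hp_norm\<close> and is identified with the pointwise
  limit of that sequence. When \<open>E\<close> is connected and \<open>\<rho>\<close> is not identically \<open>0\<close>, every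
  Cauchy sequence converges pointwise, and two of them have the same pointwise limit exactly when
  their difference tends to \<open>0\<close> in norm (Fatou). The norm of the completion is then given by the
  formula \<open>Hp_norm\<close>, whose defining sum converges for every element.
\<close>

definition Hp_space ::
  "('v \<times> 'v) set \<Rightarrow> ('v \<Rightarrow> 'v \<Rightarrow> real) \<Rightarrow> ('v \<Rightarrow> real) \<Rightarrow> ('v \<Rightarrow> real) \<Rightarrow> real
    \<Rightarrow> ('v \<Rightarrow> real) set" where
  "Hp_space E w \<sigma> \<rho> p =
     {u. \<exists>\<phi> :: nat \<Rightarrow> 'v \<Rightarrow> real.
        (\<forall>n. \<phi> n \<in> fin_supp) \<and>
        (\<forall>\<epsilon>>0. \<exists>N. \<forall>m\<ge>N. \<forall>n\<ge>N. Hp_norm E w \<sigma> \<rho> p (\<lambda>x. \<phi> m x - \<phi> n x) < \<epsilon>) \<and>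
        (\<forall>x. (\<lambda>n. \<phi> n x) \<longlonglongrightarrow> u x)}"

definition lambda_p ::
  "('v \<times> 'v) set \<Rightarrow> ('v \<Rightarrow> 'v \<Rightarrow> real) \<Rightarrow> ('v \<Rightarrow> real) \<Rightarrow> ('v \<Rightarrow> real) \<Rightarrow> real \<Rightarrow> real" where
  "lambda_p E w \<sigma> \<rho> p =
     (INF u\<in>{u \<in> Hp_space E w \<sigma> \<rho> p. \<exists>x. u x \<noteq> 0}.
        Hp_norm E w \<sigma> \<rho> p u powr p / lp_norm \<sigma> p u powr p)"

end

theory Submission
  imports Defs "HOL-Complex_Analysis.Great_Picard"
begin

text \<open>
  Positive solutions are found on finite vertex sets and then passed to the limit.

  Write \<open>energy u\<close> for the \<open>p\<close>-th power of the norm of the space and \<open>L\<close> for the operator on the left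
  of the equation, so that a solution supported in a finite set \<open>S\<close> is a critical point of
  \<open>J S u = energy u / p - (\<Sum>x\<in>S. \<sigma> x * \<Psi> x (u x))\<close>. On the nonnegative functions supported in \<open>S\<close> this
  functional has a mountain pass shape: below height \<open>\<delta>\<close> the bound
  \<open>\<psi> x s \<le> \<tau> * s powr (p - 1)\<close> with \<open>\<tau>\<close> below the first eigenvalue makes it positive away from
  \<open>0\<close>, and since \<open>\<Psi> x s\<close> grows at least like \<open>s powr \<alpha>\<close> with \<open>\<alpha> > p\<close> it is negative as soon as one value
  is large. So everything happens in a box \<open>[0, R]\<close> to the power \<open>S\<close>, on whose outer faces \<open>J S\<close> is
  negative, and a mountain pass theorem for boxes (\<open>cube_mountain_pass\<close>) applies. On the faces
  \<open>u x = 0\<close> it yields only \<open>0 \<le> L u x\<close>, but there \<open>L u x \<le> 0\<close> holds because \<open>x\<close> is a minimum; so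
  nonnegativity costs nothing (\<open>solution_on_finite_set\<close>).

  The mountain pass theorem is proved by shooting. Projected Euler steps for the gradient flow, of
  a size that vanishes where the projected gradient is small, form a continuous self-map of the box
  that never increases the functional. Along the segment from \<open>0\<close> to a point of negative level, the
  starting points whose orbits fall into the valley at \<open>0\<close> and those whose orbits reach negative
  level are two disjoint nonempty open sets. By connectedness some orbit does neither; on it the
  functional decreases but stays nonnegative, so the orbit meets points where the projected
  gradient is arbitrarily small.

  The critical level is at most the maximum of the functional on a fixed segment, whatever
  \<open>S\<close> is. With \<open>\<alpha> * \<Psi> x s \<le> s * \<psi> x s\<close> this bounds the energy of the finite solutions
  (\<open>energy_le_of_solution\<close>), hence their values, and along an exhaustion of the graph a subsequence
  converges pointwise. As \<open>L\<close> is local and continuous, the limit solves the equation. It is not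
  \<open>0\<close>, since a nonzero finite solution has a value of at least \<open>\<delta>\<close> (\<open>solution_not_small\<close>) and
  coercivity of \<open>\<rho>\<close> keeps such values in a fixed finite set. Positivity is the strong minimum
  principle. Finally, a pointwise limit of finitely supported functions of bounded energy belongs
  to the completion (\<open>bounded_energy_limit_in_Hp\<close>): near-minimisers of the energy among the finitely
  supported functions close to it form a Cauchy sequence, by uniform convexity.
\<close>

section \<open>Convexity of the power function\<close>

text \<open>
  Young's inequality for \<open>b * a powr (p - 1)\<close>. It also covers the end points \<open>a = 0\<close> and
  \<open>b = 0\<close>, where the tangent line is degenerate or the derivative is not at hand.
\<close>

lemma powr_tangent:
  fixes a b p :: real
  assumes "p > 1" "0 \<le> a" "0 \<le> b"
  shows "a powr p + p * a powr (p - 1) * (b - a) \<le> b powr p"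
proof -
  have q: "p / (p - 1) > 1" "1 / p + 1 / (p / (p - 1)) = 1"
    using assms(1) by (auto simp: field_simps)
  have "b * a powr (p - 1) \<le> b powr p / p + (a powr (p - 1)) powr (p / (p - 1)) / (p / (p - 1))"
    by (rule Youngs_inequality) (use assms q in auto)
  also have "(a powr (p - 1)) powr (p / (p - 1)) = a powr p"
    using assms(1) by (simp add: powr_powr)
  finally have "p * (b * a powr (p - 1)) \<le> b powr p + (p - 1) * a powr p"
    using assms(1) by (simp add: field_simps)
  moreover have "a * a powr (p - 1) = a powr p"
    using assms by (cases "a = 0") (auto simp: powr_mult_base)
  ultimately show ?thesis
    by (simp add: algebra_simps)
qed

lemma powr_midpoint:
  fixes a b p :: real
  assumes "p > 1" "0 \<le> a" "0 \<le> b"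
  shows "((a + b) / 2) powr p \<le> (a powr p + b powr p) / 2"
  using powr_tangent[of p "(a+b)/2" a] powr_tangent[of p "(a+b)/2" b] assms
  by (simp add: field_simps)

lemma powr_midpoint_less:
  fixes a b p :: real
  assumes p: "p > 1" and ab: "0 \<le> a" "a < b"
  shows "((a + b) / 2) powr p < (a powr p + b powr p) / 2"
proof -
  define c where "c = (a + b) / 2"
  have c: "0 < c" "a < c" "c < b" using ab by (auto simp: c_def)
  obtain z where z: "c < z" "z < b" "b powr p - c powr p = (b - c) * (p * z powr (p - 1))"
  proof -
    have "((\<lambda>x. x powr p) has_real_derivative p * x powr (p - 1)) (at x)" if "c \<le> x" for x
      using that c by (intro has_real_derivative_powr) auto
    then show ?thesis
      using MVT2[OF c(3), of "\<lambda>x. x powr p" "\<lambda>x. p * x powr (p - 1)"] that by blast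
  qed
  have "c powr (p - 1) < z powr (p - 1)"
    using z c p by (intro powr_less_mono2) auto
  then have "(b - c) * (p * c powr (p - 1)) < b powr p - c powr p"
    using z c p by auto
  moreover have "c powr p + p * c powr (p - 1) * (a - c) \<le> a powr p"
    using powr_tangent[of p c a] p ab c by simp
  moreover have "b - c = c - a" by (simp add: c_def field_simps)
  ultimately have "2 * c powr p < a powr p + b powr p"
    by (simp add: algebra_simps)
  then show ?thesis by (simp add: c_def)
qed

text \<open>
  Here \<open>A\<close>, \<open>B\<close>, \<open>M\<close>, \<open>D\<close> stand for the norms of two vectors, of their mean and of their difference
  in an inner product space: the two hypotheses are the parallelogram law and the triangle
  inequality, which is all that an inner product contributes. Working with four numbers rather than
  with vectors makes the constant independent of the dimension, which for gradients is the unbounded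
  vertex degree.

  After scaling to \<open>max A B = 1\<close> the inequality has to be shown on a compact set on which
  \<open>D\<close> is bounded away from \<open>0\<close>. There the convexity gap on the right is positive: it can vanish only
  for \<open>A = B = M\<close>, which forces \<open>D = 0\<close>. Its minimum gives the constant.
\<close>

lemma powr_uniform_convexity:
  fixes p \<epsilon> :: real
  assumes p: "p > 1" and eps: "\<epsilon> > 0"
  shows "\<exists>K>0. \<forall>A\<ge>0. \<forall>B\<ge>0. \<forall>M\<ge>0. \<forall>D\<ge>0.
    4 * M\<^sup>2 + D\<^sup>2 = 2 * A\<^sup>2 + 2 * B\<^sup>2 \<longrightarrow> 2 * M \<le> A + B \<longrightarrow>
    D powr p \<le> \<epsilon> * (A powr p + B powr p) + K * ((A powr p + B powr p) / 2 - M powr p)"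
proof -
  define X :: "(real \<times> real \<times> real \<times> real) set" where
    "X = {(A,B,M,D). 0 \<le> A \<and> 0 \<le> B \<and> 0 \<le> M \<and> 0 \<le> D \<and> max A B = 1 \<and>
       4 * M\<^sup>2 + D\<^sup>2 = 2 * A\<^sup>2 + 2 * B\<^sup>2 \<and> 2 * M \<le> A + B \<and> \<epsilon> * (A powr p + B powr p) \<le> D powr p}"
  define f :: "real \<times> real \<times> real \<times> real \<Rightarrow> real" where
    "f = (\<lambda>(A,B,M,D). (A powr p + B powr p) / 2 - M powr p)"
  have cl: "closed X"
  proof -
    define Y :: "(real \<times> real \<times> real \<times> real) set" where
      "Y = {0..} \<times> {0..} \<times> {0..} \<times> {0..}"
    have Y: "closed Y" unfolding Y_def by (intro closed_Times closed_atLeast)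
    have "X = Y \<inter> {z. max (fst z) (fst (snd z)) = 1} \<inter>
      {z. 4 * (fst (snd (snd z)))\<^sup>2 + (snd (snd (snd z)))\<^sup>2 = 2 * (fst z)\<^sup>2 + 2 * (fst (snd z))\<^sup>2} \<inter>
      {z. 2 * (fst (snd (snd z))) \<le> fst z + fst (snd z)} \<inter>
      {z\<in>Y. \<epsilon> * (fst z powr p + fst (snd z) powr p) \<le> snd (snd (snd z)) powr p}"
      unfolding X_def Y_def by (auto simp: split_beta)
    moreover have "closed {z\<in>Y. \<epsilon> * (fst z powr p + fst (snd z) powr p) \<le> snd (snd (snd z)) powr p}"
      by (intro continuous_on_closed_Collect_le Y
          continuous_intros continuous_on_powr') (use p in \<open>auto simp: Y_def\<close>)
    ultimately show ?thesis
      by (auto intro!: closed_Int closed_Collect_eq closed_Collect_le Y continuous_intros)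
  qed
  have sub: "X \<subseteq> cbox (0,0,0,0) (1,1,1,2)"
  proof
    fix z assume "z \<in> X"
    then obtain A B M D where z: "z = (A,B,M,D)" "0 \<le> A" "0 \<le> B" "0 \<le> M" "0 \<le> D" "max A B = 1"
       "4 * M\<^sup>2 + D\<^sup>2 = 2 * A\<^sup>2 + 2 * B\<^sup>2" "2 * M \<le> A + B"
      by (auto simp: X_def)
    have "A\<^sup>2 \<le> 1\<^sup>2" "B\<^sup>2 \<le> 1\<^sup>2" using z by (intro power_mono; simp)+
    then have "D\<^sup>2 \<le> 4" using z(7) zero_le_power2[of M] unfolding power_one by linarith
    then have "D\<^sup>2 \<le> 2\<^sup>2" by simp
    then have "D \<le> 2" by (rule power2_le_imp_le) simp
    then show "z \<in> cbox (0,0,0,0) (1,1,1,2)" using z by (auto simp: cbox_Pair_eq)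
  qed
  have comp: "compact X"
    using cl sub by (meson bounded_cbox bounded_subset compact_eq_bounded_closed)
  have contf: "continuous_on X f"
    unfolding f_def split_beta
    by (intro continuous_intros continuous_on_powr') (use p in \<open>auto simp: X_def\<close>)
  have fpos: "f z > 0" if "z \<in> X" for z
  proof -
    from that obtain A B M D where z: "z = (A,B,M,D)" "0 \<le> A" "0 \<le> B" "0 \<le> M" "0 \<le> D" "max A B = 1"
       "4 * M\<^sup>2 + D\<^sup>2 = 2 * A\<^sup>2 + 2 * B\<^sup>2" "2 * M \<le> A + B" "\<epsilon> * (A powr p + B powr p) \<le> D powr p"
      by (auto simp: X_def)
    have M: "M powr p \<le> ((A + B) / 2) powr p"
      using z p by (intro powr_mono2) auto
    consider "A < B" | "B < A" | "A = B" by linarith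
    then show ?thesis
    proof cases
      case 1 then show ?thesis using powr_midpoint_less[OF p, of A B] z M by (simp add: f_def)
    next
      case 2 then show ?thesis using powr_midpoint_less[OF p, of B A] z M by (simp add: f_def add.commute)
    next
      case 3
      then have A: "A = 1" "B = 1" using z by auto
      have "D > 0"
      proof (rule ccontr)
        assume "\<not> D > 0"
        then have "D = 0" using z by simp
        then show False using z(9) A eps p by simp
      qed
      then have "0 < D\<^sup>2" by simp
      then have "M\<^sup>2 < 1" using z(7) unfolding A power_one by linarith
      then have "M\<^sup>2 < 1\<^sup>2" by simp
      then have "M < 1" by (rule power2_less_imp_less) simp
      then have "M powr p < 1 powr p" using z p by (intro powr_less_mono2) auto
      then show ?thesis using z A by (simp add: f_def)
    qed
  qed
  obtain m where m: "m > 0" "\<And>z. z \<in> X \<Longrightarrow> m \<le> f z"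
  proof (cases "X = {}")
    case True then show ?thesis using that[of 1] by auto
  next
    case False
    then obtain z0 where "z0 \<in> X" "\<forall>z\<in>X. f z0 \<le> f z"
      using continuous_attains_inf[OF comp _ contf] by auto
    then show ?thesis using that[of "f z0"] fpos by auto
  qed
  define K where "K = 2 powr p / m"
  have K: "K > 0" using m by (simp add: K_def)
  show ?thesis
  proof (rule exI[of _ K], intro conjI K allI impI)
    fix A B M D :: real
    assume nn: "0 \<le> A" "0 \<le> B" "0 \<le> M" "0 \<le> D"
      and par: "4 * M\<^sup>2 + D\<^sup>2 = 2 * A\<^sup>2 + 2 * B\<^sup>2" and tri: "2 * M \<le> A + B"
    have "M powr p \<le> ((A + B) / 2) powr p"
      using nn tri p by (intro powr_mono2) auto
    then have conv: "0 \<le> (A powr p + B powr p) / 2 - M powr p"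
      using powr_midpoint[OF p nn(1,2)] by simp
    show "D powr p \<le> \<epsilon> * (A powr p + B powr p) + K * ((A powr p + B powr p) / 2 - M powr p)"
    proof (cases "D powr p \<le> \<epsilon> * (A powr p + B powr p)")
      case True
      then show ?thesis using conv K by (smt (verit) mult_nonneg_nonneg)
    next
      case False
      define s where "s = max A B"
      have s: "s > 0"
      proof (rule ccontr)
        assume "\<not> s > 0"
        then have AB: "A = 0" "B = 0" using nn by (auto simp: s_def)
        have "D\<^sup>2 \<le> 0"
          using par zero_le_power2[of M] unfolding AB zero_power2 by linarith
        then show False using False AB by simp
      qed
      \<comment> \<open>The inequality is homogeneous of degree \<open>p\<close>; scale to \<open>max A B = 1\<close>.\<close>
      have sc: "(a / s) powr p = a powr p / s powr p" if "0 \<le> a" for a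
        using that s by (simp add: powr_divide)
      have sp: "s powr p > 0" using s by simp
      have inX: "(A / s, B / s, M / s, D / s) \<in> X"
      proof -
        have "max (A / s) (B / s) = 1" using s nn by (auto simp: s_def max_def)
        moreover have "4 * (M / s)\<^sup>2 + (D / s)\<^sup>2 = 2 * (A / s)\<^sup>2 + 2 * (B / s)\<^sup>2"
        proof -
          have "4 * (M / s)\<^sup>2 + (D / s)\<^sup>2 = (4 * M\<^sup>2 + D\<^sup>2) / s\<^sup>2"
            by (simp add: power_divide add_divide_distrib)
          then show ?thesis
            by (simp add: par power_divide add_divide_distrib)
        qed
        moreover have "2 * (M / s) \<le> A / s + B / s"
          using tri s by (simp add: field_simps)
        moreover have "\<epsilon> * ((A / s) powr p + (B / s) powr p) \<le> (D / s) powr p"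
        proof -
          have "\<epsilon> * (A powr p + B powr p) / s powr p \<le> D powr p / s powr p"
            using False sp by (intro divide_right_mono) auto
          then show ?thesis by (simp add: sc nn add_divide_distrib distrib_left)
        qed
        ultimately show ?thesis using nn s by (simp add: X_def)
      qed
      have "(D / s) powr p \<le> 2 powr p"
        using sub[THEN subsetD, OF inX] p nn s by (intro powr_mono2) (auto simp: cbox_Pair_eq)
      also have "\<dots> \<le> K * f (A / s, B / s, M / s, D / s)"
        using m(2)[OF inX] m(1) by (simp add: K_def field_simps)
      also have "f (A / s, B / s, M / s, D / s) = ((A powr p + B powr p) / 2 - M powr p) / s powr p"
        by (simp add: f_def sc nn add_divide_distrib diff_divide_distrib)
      finally have "D powr p / s powr p \<le> K * ((A powr p + B powr p) / 2 - M powr p) / s powr p"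
        by (simp add: sc nn)
      then have "D powr p \<le> K * ((A powr p + B powr p) / 2 - M powr p)"
        using sp by (simp add: divide_le_cancel)
      moreover have "0 \<le> \<epsilon> * (A powr p + B powr p)" using eps by simp
      ultimately show ?thesis by linarith
    qed
  qed
qed

section \<open>A mountain pass theorem on a box\<close>

definition cube :: "'v set \<Rightarrow> real \<Rightarrow> ('v \<Rightarrow> real) set" where
  "cube S R = {u. (\<forall>x\<in>S. 0 \<le> u x \<and> u x \<le> R) \<and> (\<forall>x. x \<notin> S \<longrightarrow> u x = 0)}"

text \<open>
  Sequential continuity for pointwise convergence. For functions supported in a fixed finite set
  this is the usual continuity on a Euclidean space, without choosing coordinates.
\<close>

definition ptw_continuous_on :: "('v \<Rightarrow> real) set \<Rightarrow> (('v \<Rightarrow> real) \<Rightarrow> real) \<Rightarrow> bool" where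
  "ptw_continuous_on Q f \<longleftrightarrow> (\<forall>U u. (\<forall>n::nat. U n \<in> Q) \<longrightarrow> u \<in> Q \<longrightarrow>
     (\<forall>x. (\<lambda>n. U n x) \<longlonglongrightarrow> u x) \<longrightarrow> (\<lambda>n. f (U n)) \<longlonglongrightarrow> f u)"

lemma ptw_continuous_onD:
  assumes "ptw_continuous_on Q f" "\<And>n. U n \<in> Q" "u \<in> Q" "\<And>x. (\<lambda>n. U n x) \<longlonglongrightarrow> u x"
  shows "(\<lambda>n. f (U n)) \<longlonglongrightarrow> f u"
  using assms unfolding ptw_continuous_on_def by blast

lemma ptw_continuous_on_compose:
  fixes I :: "real set"
  assumes f: "ptw_continuous_on Q f" and Q: "\<And>s. s \<in> I \<Longrightarrow> U s \<in> Q"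
    and U: "\<And>x. continuous_on I (\<lambda>s. U s x)"
  shows "continuous_on I (\<lambda>s. f (U s))"
  unfolding continuous_on_sequentially
proof (intro allI ballI impI)
  fix X :: "nat \<Rightarrow> real" and a
  assume a: "a \<in> I" and X: "(\<forall>n. X n \<in> I) \<and> X \<longlonglongrightarrow> a"
  have "(\<lambda>n. U (X n) x) \<longlonglongrightarrow> U a x" for x
    using U[of x] a X unfolding continuous_on_sequentially by (auto simp: comp_def)
  then show "((\<lambda>s. f (U s)) \<circ> X) \<longlonglongrightarrow> f (U a)"
    using ptw_continuous_onD[OF f, of "\<lambda>n. U (X n)" "U a"] Q a X by (auto simp: comp_def)
qed

lemma cube_convergent_subsequence:
  assumes "finite S" "\<And>n. U n \<in> cube S R"
  obtains k u where "strict_mono (k :: nat \<Rightarrow> nat)" "u \<in> cube S R" "\<And>x. (\<lambda>n. U (k n) x) \<longlonglongrightarrow> u x"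
proof -
  have "countable S" using assms(1) by (rule countable_finite)
  moreover have "norm (U n x) \<le> R" if "x \<in> S" for n x
    using assms(2)[of n] that by (auto simp: cube_def)
  ultimately obtain k where k: "strict_mono (k :: nat \<Rightarrow> nat)"
      "\<And>x. x \<in> S \<Longrightarrow> \<exists>l. (\<lambda>n. U (k n) x) \<longlonglongrightarrow> l"
    using function_convergent_subsequence[of S U R] by blast
  have "\<exists>l. (\<lambda>n. U (k n) x) \<longlonglongrightarrow> l" for x
  proof (cases "x \<in> S")
    case False
    then have "(\<lambda>n. U (k n) x) = (\<lambda>_. 0)" using assms(2) by (auto simp: cube_def)
    then show ?thesis by auto
  qed (use k in auto)
  then obtain u where u: "\<And>x. (\<lambda>n. U (k n) x) \<longlonglongrightarrow> u x" by metis
  have "0 \<le> u x \<and> u x \<le> R" if "x \<in> S" for x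
    using assms(2) that by (intro conjI LIMSEQ_le_const[OF u] LIMSEQ_le_const2[OF u]) (auto simp: cube_def)
  moreover have "u x = 0" if "x \<notin> S" for x
    using assms(2) that u[of x] by (auto simp: cube_def LIMSEQ_const_iff)
  ultimately show ?thesis using that[of k u] k(1) u by (auto simp: cube_def)
qed

lemma cube_bounded:
  assumes S: "finite S" and f: "ptw_continuous_on (cube S R) f"
  obtains K where "K > 0" "\<And>u. u \<in> cube S R \<Longrightarrow> \<bar>f u\<bar> \<le> K"
proof -
  have "\<exists>n::nat. \<forall>u\<in>cube S R. \<bar>f u\<bar> \<le> real n"
  proof (rule ccontr)
    assume "\<not> ?thesis"
    then obtain U where U: "\<And>n. U n \<in> cube S R" "\<And>n::nat. real n < \<bar>f (U n)\<bar>"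
      by (metis not_le)
    obtain k u where k: "strict_mono k" "u \<in> cube S R" "\<And>x. (\<lambda>n. U (k n) x) \<longlonglongrightarrow> u x"
      using cube_convergent_subsequence[of S U R, OF S U(1)] by blast
    have "(\<lambda>n. f (U (k n))) \<longlonglongrightarrow> f u"
      by (rule ptw_continuous_onD[OF f]) (use U k in auto)
    then obtain K where K: "\<And>n. \<bar>f (U (k n))\<bar> \<le> K"
      using convergent_imp_Bseq[of "\<lambda>n. f (U (k n))"] by (auto simp: convergent_def Bseq_def)
    obtain n where "K < real n" using reals_Archimedean2 by blast
    then show False using K[of n] U(2)[of "k n"] seq_suble[OF k(1), of n]
      by (smt (verit) of_nat_mono)
  qed
  then obtain n :: nat where n: "\<forall>u\<in>cube S R. \<bar>f u\<bar> \<le> real n" ..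
  show ?thesis by (rule that[of "real n + 1"]) (use n in \<open>auto intro: order_trans\<close>)
qed

text \<open>
  Heine--Cantor, with sequential compactness of the box in place of a metric.
\<close>

lemma cube_uniformly_continuous:
  assumes S: "finite S" and f: "\<And>x. x \<in> S \<Longrightarrow> ptw_continuous_on (cube S R) (f x)" and \<omega>: "\<omega> > 0"
  shows "\<exists>d>0. \<forall>u\<in>cube S R. \<forall>h\<in>cube S R. (\<forall>y\<in>S. \<bar>h y - u y\<bar> \<le> d) \<longrightarrow> (\<forall>x\<in>S. \<bar>f x h - f x u\<bar> \<le> \<omega>)"
proof -
  have "\<exists>d>0. \<forall>u\<in>cube S R. \<forall>h\<in>cube S R. (\<forall>y\<in>S. \<bar>h y - u y\<bar> \<le> d) \<longrightarrow> \<bar>f x h - f x u\<bar> \<le> \<omega>"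
    if x: "x \<in> S" for x
  proof (rule ccontr)
    assume neg: "\<not> ?thesis"
    have "\<exists>u h. u \<in> cube S R \<and> h \<in> cube S R \<and> (\<forall>y\<in>S. \<bar>h y - u y\<bar> \<le> inverse (real (Suc n))) \<and>
      \<omega> < \<bar>f x h - f x u\<bar>" for n
    proof -
      have "inverse (real (Suc n)) > 0" by simp
      then show ?thesis using neg by (meson not_le)
    qed
    then obtain U H where UH: "\<And>n. U n \<in> cube S R" "\<And>n. H n \<in> cube S R"
      "\<And>n y. y \<in> S \<Longrightarrow> \<bar>H n y - U n y\<bar> \<le> inverse (real (Suc n))" "\<And>n. \<omega> < \<bar>f x (H n) - f x (U n)\<bar>"
      by metis
    obtain k u where k: "strict_mono k" "u \<in> cube S R" "\<And>y. (\<lambda>n. U (k n) y) \<longlonglongrightarrow> u y"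
      using cube_convergent_subsequence[of S U R, OF S UH(1)] by blast
    have H: "(\<lambda>n. H (k n) y) \<longlonglongrightarrow> u y" for y
    proof -
      have "(\<lambda>n. inverse (real (Suc (k n)))) \<longlonglongrightarrow> 0"
        using LIMSEQ_subseq_LIMSEQ[OF LIMSEQ_inverse_real_of_nat k(1)] by (simp add: comp_def)
      moreover have "\<bar>H n y - U n y\<bar> \<le> inverse (real (Suc n))" for n
        using UH(1)[of n] UH(2)[of n] UH(3)[of y n] by (cases "y \<in> S") (auto simp: cube_def)
      ultimately have "(\<lambda>n. H (k n) y - U (k n) y) \<longlonglongrightarrow> 0"
        by (intro Lim_null_comparison[of "\<lambda>n. H (k n) y - U (k n) y" "\<lambda>n. inverse (real (Suc (k n)))"]) auto
      then show ?thesis using tendsto_add[OF _ k(3)[of y], of "\<lambda>n. H (k n) y - U (k n) y" 0] by simp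
    qed
    have "(\<lambda>n. f x (H (k n))) \<longlonglongrightarrow> f x u"
      by (rule ptw_continuous_onD[OF f[OF x]]) (use UH k H in auto)
    moreover have "(\<lambda>n. f x (U (k n))) \<longlonglongrightarrow> f x u"
      by (rule ptw_continuous_onD[OF f[OF x]]) (use UH k in auto)
    ultimately have "(\<lambda>n. \<bar>f x (H (k n)) - f x (U (k n))\<bar>) \<longlonglongrightarrow> \<bar>f x u - f x u\<bar>"
      by (intro tendsto_intros)
    then have "\<omega> \<le> \<bar>f x u - f x u\<bar>"
      by (rule LIMSEQ_le_const) (use UH(4) in \<open>auto intro: less_imp_le\<close>)
    then show False using \<omega> by simp
  qed
  then obtain d where d: "\<And>x. x \<in> S \<Longrightarrow> d x > 0"
    "\<And>x u h. x \<in> S \<Longrightarrow> u \<in> cube S R \<Longrightarrow> h \<in> cube S R \<Longrightarrow> (\<forall>y\<in>S. \<bar>h y - u y\<bar> \<le> d x) \<Longrightarrow>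
      \<bar>f x h - f x u\<bar> \<le> \<omega>"
    by metis
  define m where "m = Min (insert 1 (d ` S))"
  have m: "m > 0" "\<And>x. x \<in> S \<Longrightarrow> m \<le> d x"
    using S d(1) by (auto simp: m_def)
  show ?thesis
  proof (intro exI[of _ m] conjI m(1) ballI impI)
    fix u h x assume "u \<in> cube S R" "h \<in> cube S R" "\<forall>y\<in>S. \<bar>h y - u y\<bar> \<le> m" "x \<in> S"
    then show "\<bar>f x h - f x u\<bar> \<le> \<omega>"
      using m(2)[of x] by (intro d(2)) force+
  qed
qed

definition clip :: "real \<Rightarrow> real \<Rightarrow> real" where
  "clip R a = max 0 (min R a)"

lemma clip_bounds: "0 \<le> R \<Longrightarrow> 0 \<le> clip R a \<and> clip R a \<le> R"
  by (auto simp: clip_def)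

text \<open>
  One coordinate of a projected Euler step of size \<open>t\<close> with slope \<open>c\<close>. The step goes downhill, and its
  length is at least \<open>t\<close> times that of the step of size \<open>1\<close>: so the latter measures, at every
  smaller step size, how far the point is from being critical.
\<close>

lemma clip_step:
  fixes a c t R :: real
  assumes "0 \<le> a" "a \<le> R" "0 \<le> t" "t \<le> 1"
  defines "d \<equiv> clip R (a - t * c) - a" and "d1 \<equiv> clip R (a - c) - a"
  shows "c * d = - (\<bar>c\<bar> * \<bar>d\<bar>)" "\<bar>d\<bar> \<le> t * \<bar>c\<bar>" "t * \<bar>d1\<bar> \<le> \<bar>d\<bar>" "\<bar>d1\<bar> \<le> \<bar>c\<bar>"
proof -
  have nn: "0 \<le> t * \<bar>c\<bar>" using assms by simp
  have 1: "t * a \<le> a" "t * (R - a) \<le> R - a"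
    using assms(1-4) by (auto intro: mult_left_le_one_le)
  have "(0 \<le> c \<and> d \<le> 0 \<and> d = - min a (t * c) \<and> d1 = - min a c) \<or>
        (c \<le> 0 \<and> 0 \<le> d \<and> d = min (R - a) (t * - c) \<and> d1 = min (R - a) (- c))"
  proof (cases "0 \<le> c")
    case True
    then have "0 \<le> t * c" using assms by simp
    then have "min R (a - t * c) = a - t * c" "min R (a - c) = a - c"
      using True assms(1-4) by linarith+
    then show ?thesis using True assms(1-4) \<open>0 \<le> t * c\<close> by (auto simp: d_def d1_def clip_def min_def max_def)
  next
    case False
    then have "t * c \<le> 0" using assms by (simp add: mult_nonneg_nonpos)
    then have "max 0 (min R (a - t * c)) = min R (a - t * c)" "max 0 (min R (a - c)) = min R (a - c)"
      using False assms(1-4) by linarith+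
    then show ?thesis using False assms(1-4) \<open>t * c \<le> 0\<close> by (auto simp: d_def d1_def clip_def min_def max_def)
  qed
  then consider "0 \<le> c" "d \<le> 0" "d = - min a (t * c)" "d1 = - min a c"
    | "c \<le> 0" "0 \<le> d" "d = min (R - a) (t * - c)" "d1 = min (R - a) (- c)" by blast
  then have "c * d = - (\<bar>c\<bar> * \<bar>d\<bar>) \<and> \<bar>d\<bar> \<le> t * \<bar>c\<bar> \<and> t * \<bar>d1\<bar> \<le> \<bar>d\<bar> \<and> \<bar>d1\<bar> \<le> \<bar>c\<bar>"
  proof cases
    case 1
    have "t * \<bar>d1\<bar> = min (t * a) (t * c)"
      using 1 assms(1-4) by (simp add: min_mult_distrib_left)
    then show ?thesis
      using 1 assms(1-4) \<open>t * a \<le> a\<close> nn by auto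
  next
    case 2
    have "t * \<bar>d1\<bar> = min (t * (R - a)) (t * - c)"
      using 2 assms(1-4) by (simp add: min_mult_distrib_left)
    then show ?thesis
      using 2 assms(1-4) \<open>t * (R - a) \<le> R - a\<close> nn by auto
  qed
  then show "c * d = - (\<bar>c\<bar> * \<bar>d\<bar>)" "\<bar>d\<bar> \<le> t * \<bar>c\<bar>" "t * \<bar>d1\<bar> \<le> \<bar>d\<bar>" "\<bar>d1\<bar> \<le> \<bar>c\<bar>" by blast+
qed

text \<open>
  Vanishes exactly at the critical points of the functional with gradient \<open>g\<close>, relative to the box.
\<close>

definition residual :: "'v set \<Rightarrow> real \<Rightarrow> (('v \<Rightarrow> real) \<Rightarrow> 'v \<Rightarrow> real) \<Rightarrow> ('v \<Rightarrow> real) \<Rightarrow> real" where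
  "residual S R g u = (\<Sum>x\<in>S. (clip R (u x - g u x) - u x)\<^sup>2)"

lemma residual_continuous:
  assumes g: "\<And>x. x \<in> S \<Longrightarrow> ptw_continuous_on (cube S R) (\<lambda>u. g u x)"
  shows "ptw_continuous_on (cube S R) (residual S R g)"
  unfolding ptw_continuous_on_def residual_def clip_def
  by (intro allI impI tendsto_intros) (auto intro: ptw_continuous_onD[OF g])

text \<open>
  A gradient that is merely continuous does not give descent for a fixed step size near critical
  points, because the error of the first-order expansion is only small compared with the length of
  the step. The step is therefore scaled by a continuous cutoff that stops the motion where the
  residual is at most \<open>\<epsilon>\<close>; elsewhere the gain, proportional to the residual, beats that error.
\<close>

lemma cube_descent_step:
  assumes S: "finite S" and R: "R > 0"
    and g: "\<And>x. x \<in> S \<Longrightarrow> ptw_continuous_on (cube S R) (\<lambda>u. g u x)"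
    and smooth: "\<And>\<omega>. \<omega> > 0 \<Longrightarrow> \<exists>\<delta>>0. \<forall>u\<in>cube S R. \<forall>h\<in>cube S R. (\<forall>x\<in>S. \<bar>h x - u x\<bar> \<le> \<delta>) \<longrightarrow>
      J h \<le> J u + (\<Sum>x\<in>S. g u x * (h x - u x)) + \<omega> * (\<Sum>x\<in>S. \<bar>h x - u x\<bar>)"
    and eps: "\<epsilon> > 0" and r: "r > 0"
  shows "\<exists>T c. c > 0 \<and> (\<forall>x. ptw_continuous_on (cube S R) (\<lambda>u. T u x)) \<and>
    (\<forall>u\<in>cube S R. T u \<in> cube S R \<and> (\<forall>x\<in>S. \<bar>T u x - u x\<bar> \<le> r) \<and> J (T u) \<le> J u \<and>
      (2 * \<epsilon> \<le> residual S R g u \<longrightarrow> J (T u) \<le> J u - c))"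
proof -
  have "ptw_continuous_on (cube S R) (\<lambda>u. \<Sum>x\<in>S. \<bar>g u x\<bar>)"
    unfolding ptw_continuous_on_def
    by (intro allI impI tendsto_intros) (auto intro: ptw_continuous_onD[OF g])
  then obtain G where G: "G > 0" "\<And>u. u \<in> cube S R \<Longrightarrow> \<bar>\<Sum>x\<in>S. \<bar>g u x\<bar>\<bar> \<le> G"
    using cube_bounded[OF S] by blast
  have Gx: "\<bar>g u x\<bar> \<le> G" if "u \<in> cube S R" "x \<in> S" for u x
    using member_le_sum[of x S "\<lambda>x. \<bar>g u x\<bar>"] G(2)[OF that(1)] that S by auto
  \<comment> \<open>Chosen so that the first-order error costs at most \<open>\<epsilon> / 2\<close> per unit of step size.\<close>
  define \<omega> where "\<omega> = \<epsilon> / (2 * G)"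
  have "\<omega> > 0" using eps G by (simp add: \<omega>_def)
  then obtain \<delta> where \<delta>: "\<delta> > 0" "\<And>u h. u \<in> cube S R \<Longrightarrow> h \<in> cube S R \<Longrightarrow> (\<And>x. x \<in> S \<Longrightarrow> \<bar>h x - u x\<bar> \<le> \<delta>) \<Longrightarrow>
      J h \<le> J u + (\<Sum>x\<in>S. g u x * (h x - u x)) + \<omega> * (\<Sum>x\<in>S. \<bar>h x - u x\<bar>)"
    using smooth by meson
  define t where "t = min 1 (min \<delta> r / G)"
  have t: "0 < t" "t \<le> 1" "t * G \<le> \<delta>" "t * G \<le> r"
    using \<delta>(1) r G(1) by (auto simp: t_def min_def field_simps)
  define \<eta> where "\<eta> u = min 1 (max 0 (residual S R g u - \<epsilon>))" for u
  have \<eta>: "0 \<le> \<eta> u" "\<eta> u \<le> 1" for u by (auto simp: \<eta>_def)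
  define T where "T u = (\<lambda>x. if x \<in> S then clip R (u x - t * \<eta> u * g u x) else 0)" for u
  have Tc: "ptw_continuous_on (cube S R) (\<lambda>u. T u x)" for x
  proof (cases "x \<in> S")
    case True
    then show ?thesis
      unfolding ptw_continuous_on_def T_def clip_def \<eta>_def
      by (auto intro!: tendsto_intros intro: ptw_continuous_onD[OF g] ptw_continuous_onD[OF residual_continuous[OF g]])
  qed (auto simp: ptw_continuous_on_def T_def)
  have TQ: "T u \<in> cube S R" for u
    using R clip_bounds[of R] by (auto simp: T_def cube_def)
  have te: "0 \<le> t * \<eta> u" "t * \<eta> u \<le> 1" "t * \<eta> u \<le> t" for u
    using t \<eta>[of u] by (auto intro: mult_le_one mult_left_le)
  have disp: "\<bar>T u x - u x\<bar> \<le> t * \<eta> u * \<bar>g u x\<bar>" if "u \<in> cube S R" "x \<in> S" for u x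
    using clip_step(2)[of "u x" R "t * \<eta> u" "g u x"] te[of u] that by (auto simp: T_def cube_def)
  have disp2: "\<bar>T u x - u x\<bar> \<le> t * G" if "u \<in> cube S R" "x \<in> S" for u x
  proof -
    have "t * \<eta> u * \<bar>g u x\<bar> \<le> t * G" using te[of u] Gx[OF that] t by (intro mult_mono) auto
    then show ?thesis using disp[OF that] by linarith
  qed
  have desc: "J (T u) \<le> J u - t * \<eta> u * (residual S R g u - \<epsilon> / 2)" if u: "u \<in> cube S R" for u
  proof -
    have "J (T u) \<le> J u + (\<Sum>x\<in>S. g u x * (T u x - u x)) + \<omega> * (\<Sum>x\<in>S. \<bar>T u x - u x\<bar>)"
      by (rule \<delta>(2)[OF u TQ]) (use disp2[OF u] t in force)
    moreover have "g u x * (T u x - u x) \<le> - (t * \<eta> u * (clip R (u x - g u x) - u x)\<^sup>2)" if x: "x \<in> S" for x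
    proof -
      define d where "d = clip R (u x - t * \<eta> u * g u x) - u x"
      define d1 where "d1 = clip R (u x - g u x) - u x"
      have ux: "0 \<le> u x" "u x \<le> R" using u x by (auto simp: cube_def)
      note cs = clip_step[OF ux te(1)[of u] te(2)[of u], of "g u x", folded d_def d1_def]
      have "t * \<eta> u * d1\<^sup>2 = \<bar>d1\<bar> * (t * \<eta> u * \<bar>d1\<bar>)" by (simp add: power2_eq_square)
      also have "\<dots> \<le> \<bar>g u x\<bar> * \<bar>d\<bar>"
        using cs te[of u] by (intro mult_mono) auto
      finally show ?thesis using cs(1) x by (simp add: T_def d_def d1_def)
    qed
    then have "(\<Sum>x\<in>S. g u x * (T u x - u x)) \<le> (\<Sum>x\<in>S. - (t * \<eta> u * (clip R (u x - g u x) - u x)\<^sup>2))"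
      by (rule sum_mono)
    then have "(\<Sum>x\<in>S. g u x * (T u x - u x)) \<le> - (t * \<eta> u * residual S R g u)"
      by (simp add: residual_def sum_negf sum_distrib_left)
    moreover have "(\<Sum>x\<in>S. \<bar>T u x - u x\<bar>) \<le> t * \<eta> u * G"
    proof -
      have "(\<Sum>x\<in>S. \<bar>T u x - u x\<bar>) \<le> (\<Sum>x\<in>S. t * \<eta> u * \<bar>g u x\<bar>)"
        by (rule sum_mono) (rule disp[OF u])
      also have "\<dots> = t * \<eta> u * (\<Sum>x\<in>S. \<bar>g u x\<bar>)" by (simp add: sum_distrib_left)
      also have "\<dots> \<le> t * \<eta> u * G" using G(2)[OF u] te[of u] by (intro mult_left_mono) auto
      finally show ?thesis .
    qed
    then have "\<omega> * (\<Sum>x\<in>S. \<bar>T u x - u x\<bar>) \<le> \<omega> * (t * \<eta> u * G)"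
      using \<open>\<omega> > 0\<close> by (intro mult_left_mono) auto
    moreover have "\<omega> * (t * \<eta> u * G) = t * \<eta> u * (\<epsilon> / 2)" using G by (simp add: \<omega>_def)
    ultimately show ?thesis unfolding right_diff_distrib by linarith
  qed
  have mono: "J (T u) \<le> J u" if "u \<in> cube S R" for u
  proof (cases "residual S R g u \<le> \<epsilon>")
    case True
    then have "\<eta> u = 0" by (simp add: \<eta>_def)
    then show ?thesis using desc[OF that] by simp
  next
    case False
    then have "0 \<le> t * \<eta> u * (residual S R g u - \<epsilon> / 2)"
      using te(1)[of u] eps by (intro mult_nonneg_nonneg[OF te(1)]) auto
    then show ?thesis using desc[OF that] by linarith
  qed
  have strict: "J (T u) \<le> J u - t * min 1 \<epsilon> * (\<epsilon> / 2)"
    if u: "u \<in> cube S R" and "2 * \<epsilon> \<le> residual S R g u" for u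
  proof -
    have "min 1 \<epsilon> \<le> \<eta> u" using that eps by (auto simp: \<eta>_def)
    then have "t * min 1 \<epsilon> * (\<epsilon> / 2) \<le> t * \<eta> u * (residual S R g u - \<epsilon> / 2)"
      using that eps t te[of u] by (intro mult_mono) auto
    then show ?thesis using desc[OF u] by linarith
  qed
  have c: "t * min 1 \<epsilon> * (\<epsilon> / 2) > 0" using t eps by simp
  have small: "\<bar>T u x - u x\<bar> \<le> r" if "u \<in> cube S R" "x \<in> S" for u x
    using disp2[OF that] t by linarith
  show ?thesis
  proof (rule exI[of _ T], rule exI[of _ "t * min 1 \<epsilon> * (\<epsilon> / 2)"], intro conjI allI ballI impI)
    show "0 < t * min 1 \<epsilon> * (\<epsilon> / 2)" by (rule c)
    show "ptw_continuous_on (cube S R) (\<lambda>u. T u x)" for x by (rule Tc)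
    fix u assume u: "u \<in> cube S R"
    show "T u \<in> cube S R" by (rule TQ)
    show "\<bar>T u x - u x\<bar> \<le> r" if "x \<in> S" for x by (rule small[OF u that])
    show "J (T u) \<le> J u" by (rule mono[OF u])
    show "J (T u) \<le> J u - t * min 1 \<epsilon> * (\<epsilon> / 2)" if "2 * \<epsilon> \<le> residual S R g u"
      by (rule strict[OF u that])
  qed
qed

text \<open>
  The assumption \<open>valley\<close> says that the sublevel set of \<open>b\<close> near \<open>0\<close> is separated from the rest by the
  shell between heights \<open>r / 2\<close> and \<open>r\<close>, which steps of length at most \<open>r / 2\<close> cannot cross. The
  conclusion that \<open>u\<close> is fixed by the projected step is the first-order condition on the box: \<open>g u x\<close>
  vanishes at interior values and has the sign that blocks descent on the faces.
\<close>

theorem cube_mountain_pass: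
  assumes S: "finite S" and R: "R > 0"
    and J: "ptw_continuous_on (cube S R) J"
    and g: "\<And>x. x \<in> S \<Longrightarrow> ptw_continuous_on (cube S R) (\<lambda>u. g u x)"
    and smooth: "\<And>\<omega>. \<omega> > 0 \<Longrightarrow> \<exists>\<delta>>0. \<forall>u\<in>cube S R. \<forall>h\<in>cube S R. (\<forall>x\<in>S. \<bar>h x - u x\<bar> \<le> \<delta>) \<longrightarrow>
      J h \<le> J u + (\<Sum>x\<in>S. g u x * (h x - u x)) + \<omega> * (\<Sum>x\<in>S. \<bar>h x - u x\<bar>)"
    and b: "J (\<lambda>_. 0) < b" and r: "r > 0"
    and valley: "\<And>u. u \<in> cube S R \<Longrightarrow> (\<And>x. x \<in> S \<Longrightarrow> u x < r) \<Longrightarrow> J u < b \<Longrightarrow>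
      0 \<le> J u \<and> (\<forall>x\<in>S. u x < r / 2)"
    and e: "e \<in> cube S R" "J e < 0"
    and C: "\<And>s. 0 \<le> s \<Longrightarrow> s \<le> 1 \<Longrightarrow> J (\<lambda>x. s * e x) \<le> C"
  obtains u where "u \<in> cube S R" "u \<noteq> (\<lambda>_. 0)" "0 \<le> J u" "J u \<le> C"
    "\<And>x. x \<in> S \<Longrightarrow> clip R (u x - g u x) = u x"
proof -
  define V where "V = {u \<in> cube S R. J u < b \<and> (\<forall>x\<in>S. u x < r)}"
  have approx: "\<exists>u. u \<in> cube S R \<and> u \<notin> V \<and> 0 \<le> J u \<and> J u \<le> C \<and> residual S R g u \<le> 2 * \<epsilon>"
    if eps: "\<epsilon> > 0" for \<epsilon>
  proof -
    have r2: "r / 2 > 0" using r by simp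
    have "\<exists>T c. c > 0 \<and> (\<forall>x. ptw_continuous_on (cube S R) (\<lambda>u. T u x)) \<and>
      (\<forall>u\<in>cube S R. T u \<in> cube S R \<and> (\<forall>x\<in>S. \<bar>T u x - u x\<bar> \<le> r / 2) \<and> J (T u) \<le> J u \<and>
        (2 * \<epsilon> \<le> residual S R g u \<longrightarrow> J (T u) \<le> J u - c))"
      by (rule cube_descent_step[OF S R g smooth eps r2])
    then obtain T c where T0: "c > 0" "\<forall>x. ptw_continuous_on (cube S R) (\<lambda>u. T u x)"
      "\<forall>u\<in>cube S R. T u \<in> cube S R \<and> (\<forall>x\<in>S. \<bar>T u x - u x\<bar> \<le> r / 2) \<and> J (T u) \<le> J u \<and>
        (2 * \<epsilon> \<le> residual S R g u \<longrightarrow> J (T u) \<le> J u - c)"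
      by blast
    have T: "c > 0" "\<And>x. ptw_continuous_on (cube S R) (\<lambda>u. T u x)"
      "\<And>u. u \<in> cube S R \<Longrightarrow> T u \<in> cube S R"
      "\<And>u x. u \<in> cube S R \<Longrightarrow> x \<in> S \<Longrightarrow> \<bar>T u x - u x\<bar> \<le> r / 2"
      "\<And>u. u \<in> cube S R \<Longrightarrow> J (T u) \<le> J u"
      "\<And>u. u \<in> cube S R \<Longrightarrow> 2 * \<epsilon> \<le> residual S R g u \<Longrightarrow> J (T u) \<le> J u - c"
      using T0 by simp_all
    define orb where "orb k s = (T ^^ k) (\<lambda>x. s * e x)" for k and s :: real
    have orb_Suc: "orb (Suc k) s = T (orb k s)" for k s by (simp add: orb_def)
    have orbQ: "orb k s \<in> cube S R" if "s \<in> {0..1}" for k s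
    proof (induction k)
      case 0
      have "s * e x \<le> R" if "x \<in> S" for x
        using mult_mono[of s 1 "e x" R] \<open>s \<in> {0..1}\<close> e that R by (auto simp: cube_def)
      then show ?case using that e by (auto simp: orb_def cube_def)
    qed (simp add: orb_Suc T)
    have orbc: "continuous_on {0..1} (\<lambda>s. orb k s x)" for k x
    proof (induction k arbitrary: x)
      case 0 then show ?case by (simp add: orb_def continuous_intros)
    next
      case (Suc k)
      show ?case unfolding orb_Suc
        by (rule ptw_continuous_on_compose[OF T(2) orbQ Suc])
    qed
    have Jc: "continuous_on {0..1} (\<lambda>s. J (orb k s))" for k
      by (rule ptw_continuous_on_compose[OF J orbQ orbc])
    have Jmono: "J (orb (k + i) s) \<le> J (orb k s)" if "s \<in> {0..1}" for k i s
      by (induction i) (auto simp: orb_Suc intro: order_trans[OF T(5)[OF orbQ[OF that]]])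
    have Vstep: "T u \<in> V" if "u \<in> V" for u
    proof -
      have u: "u \<in> cube S R" "J u < b" "\<And>x. x \<in> S \<Longrightarrow> u x < r" using that by (auto simp: V_def)
      have "T u x < r" if "x \<in> S" for x
      proof -
        have "u x < r / 2" using valley[OF u(1) _ u(2)] u(3) that by blast
        then show ?thesis using T(4)[OF u(1) that] by linarith
      qed
      then show ?thesis using u T(3)[OF u(1)] T(5)[OF u(1)] by (auto simp: V_def)
    qed
    have Viter: "orb (k + i) s \<in> V" if "orb k s \<in> V" for k i s
      by (induction i) (use that Vstep in \<open>auto simp: orb_Suc\<close>)
    \<comment> \<open>\<open>A\<close> collects the starting points of orbits that fall into the valley, \<open>B\<close> those of orbits that reach negative level; both events persist under further steps.\<close>
    define A where "A = (\<Union>k. {0..1} \<inter> {s \<in> {0..1}. orb k s \<in> V})"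
    define B where "B = (\<Union>k. {0..1} \<inter> (\<lambda>s. J (orb k s)) -` {..<0})"
    have openA: "openin (top_of_set {0..1}) A"
      unfolding A_def
    proof (intro openin_Union ballI, clarify)
      fix k
      have "{0..1} \<inter> {s \<in> {0..1}. orb k s \<in> V} =
        ({0..1} \<inter> (\<lambda>s. J (orb k s)) -` {..<b}) \<inter> (\<Inter>x\<in>S. {0..1} \<inter> (\<lambda>s. orb k s x) -` {..<r}) \<inter> {0..1}"
        using orbQ by (auto simp: V_def)
      moreover have "openin (top_of_set {0..1}) \<dots>"
      proof (cases "S = {}")
        case True
        then show ?thesis
          by (auto intro!: continuous_openin_preimage_gen Jc)
      next
        case False
        then show ?thesis using S
          by (intro openin_Int openin_INT2 continuous_openin_preimage_gen Jc orbc) auto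
      qed
      ultimately show "openin (top_of_set {0..1}) ({0..1} \<inter> {s \<in> {0..1}. orb k s \<in> V})" by simp
    qed
    have openB: "openin (top_of_set {0..1}) B"
      unfolding B_def
      by (intro openin_Union ballI, clarify) (intro continuous_openin_preimage_gen Jc open_lessThan)
    have "A \<inter> B = {}"
    proof (rule ccontr)
      assume "A \<inter> B \<noteq> {}"
      then obtain s k l where s: "s \<in> {0..1}" "orb k s \<in> V" "J (orb l s) < 0"
        by (auto simp: A_def B_def)
      have "orb (k + l) s \<in> V" using Viter s by blast
      then have "0 \<le> J (orb (k + l) s)" using valley by (auto simp: V_def)
      moreover have "J (orb (l + k) s) \<le> J (orb l s)" using Jmono s by blast
      ultimately show False using s by (simp add: add.commute)
    qed
    moreover have "0 \<in> A"
    proof -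
      have "orb 0 0 \<in> V" using b r R by (auto simp: orb_def V_def cube_def)
      then show ?thesis by (auto simp: A_def)
    qed
    moreover have "1 \<in> B"
      using e by (auto simp: B_def orb_def intro!: exI[of _ 0])
    ultimately have "\<not> {0..1} \<subseteq> A \<union> B"
      using connected_Icc[of "0::real" 1] openA openB unfolding connected_openin by blast
    then obtain s where s: "s \<in> {0..1}" "s \<notin> A" "s \<notin> B" by blast
    have nV: "orb k s \<notin> V" and Jn: "0 \<le> J (orb k s)" for k
      using s by (auto simp: A_def B_def not_less)
    have "\<exists>k. residual S R g (orb k s) < 2 * \<epsilon>"
    proof (rule ccontr)
      assume "\<not> ?thesis"
      then have dec: "J (orb (Suc k) s) \<le> J (orb k s) - c" for k
        using T(6)[OF orbQ[OF s(1)]] by (auto simp: orb_Suc not_less)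
      have "J (orb k s) \<le> J (orb 0 s) - k * c" for k
      proof (induction k)
        case (Suc k) then show ?case using dec[of k] by (simp add: algebra_simps)
      qed simp
      moreover obtain k :: nat where "J (orb 0 s) / c < k" using reals_Archimedean2 by blast
      ultimately show False using Jn[of k] T(1) by (smt (verit) pos_divide_less_eq)
    qed
    then obtain k where "residual S R g (orb k s) < 2 * \<epsilon>" by blast
    moreover have "J (orb k s) \<le> C"
      using Jmono[OF s(1), of 0 k] C[of s] s(1) by (auto simp: orb_def)
    ultimately show ?thesis using orbQ[OF s(1), of k] nV Jn by force
  qed
  have "\<exists>u. u \<in> cube S R \<and> u \<notin> V \<and> 0 \<le> J u \<and> J u \<le> C \<and> residual S R g u \<le> 2 * inverse (real (Suc n))" for n
    by (rule approx) simp
  then obtain U where U: "\<And>n. U n \<in> cube S R" "\<And>n. U n \<notin> V" "\<And>n. 0 \<le> J (U n)" "\<And>n. J (U n) \<le> C"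
      "\<And>n. residual S R g (U n) \<le> 2 * inverse (real (Suc n))"
    by metis
  obtain k u where k: "strict_mono k" "u \<in> cube S R" "\<And>x. (\<lambda>n. U (k n) x) \<longlonglongrightarrow> u x"
    using cube_convergent_subsequence[of S U R, OF S U(1)] by blast
  have Ju: "(\<lambda>n. J (U (k n))) \<longlonglongrightarrow> J u"
    by (rule ptw_continuous_onD[OF J]) (use U k in auto)
  have res: "(\<lambda>n. residual S R g (U (k n))) \<longlonglongrightarrow> residual S R g u"
    by (rule ptw_continuous_onD[OF residual_continuous[OF g]]) (use U k in auto)
  have lim: "(\<lambda>n. 2 * inverse (real (Suc (k n)))) \<longlonglongrightarrow> 2 * 0"
    using LIMSEQ_subseq_LIMSEQ[OF LIMSEQ_inverse_real_of_nat k(1)]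
    by (intro tendsto_mult_left) (simp add: comp_def)
  have "residual S R g u \<le> 2 * 0"
    by (rule LIMSEQ_le[OF res lim]) (use U(5) in blast)
  then have "residual S R g u = 0" by (simp add: residual_def sum_nonneg order_antisym)
  then have crit: "clip R (u x - g u x) = u x" if "x \<in> S" for x
    using that S by (simp add: residual_def sum_nonneg_eq_0_iff)
  have "u \<noteq> (\<lambda>_. 0)"
  proof
    assume u0: "u = (\<lambda>_. 0)"
    have "\<forall>\<^sub>F n in sequentially. J (U (k n)) < b"
      using Ju b u0 by (intro order_tendstoD) auto
    moreover have "\<forall>\<^sub>F n in sequentially. \<forall>x\<in>S. U (k n) x < r"
      using k(3) u0 r S by (intro eventually_ball_finite ballI order_tendstoD(2)) auto
    ultimately have "\<forall>\<^sub>F n in sequentially. U (k n) \<in> V"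
      by eventually_elim (use U in \<open>auto simp: V_def\<close>)
    then show False using U(2) by simp
  qed
  moreover have "0 \<le> J u" "J u \<le> C"
    using U by (auto intro: LIMSEQ_le_const[OF Ju] LIMSEQ_le_const2[OF Ju])
  ultimately show ?thesis using that k(2) crit by blast
qed

section \<open>The energy on a weighted graph\<close>

locale weighted_graph =
  fixes E :: "('v \<times> 'v) set" and w :: "'v \<Rightarrow> 'v \<Rightarrow> real" and \<sigma> \<rho> :: "'v \<Rightarrow> real" and p :: real
  assumes sym_E: "sym E"
    and locally_finite: "finite (E `` {x})"
    and weight_sym: "(x, y) \<in> E \<Longrightarrow> w x y = w y x"
    and weight_pos: "(x, y) \<in> E \<Longrightarrow> w x y > 0"
    and sigma_pos: "\<sigma> x > 0"
    and p: "p > 1"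
    and rho_nonneg: "\<rho> x \<ge> 0"
begin

abbreviation G :: "('v \<Rightarrow> real) \<Rightarrow> 'v \<Rightarrow> real" where
  "G \<equiv> grad_norm E w \<sigma>"

definition grad_inner :: "('v \<Rightarrow> real) \<Rightarrow> ('v \<Rightarrow> real) \<Rightarrow> 'v \<Rightarrow> real" where
  "grad_inner u v x = 1 / (2 * \<sigma> x) * (\<Sum>y\<in>E `` {x}. w x y * ((u y - u x) * (v y - v x)))"

definition energy :: "('v \<Rightarrow> real) \<Rightarrow> real" where
  "energy u = vint \<sigma> (\<lambda>x. G u x powr p + \<rho> x * \<bar>u x\<bar> powr p)"

definition L :: "('v \<Rightarrow> real) \<Rightarrow> 'v \<Rightarrow> real" where
  "L u x = - p_laplacian E w \<sigma> p u x + \<rho> x * \<bar>u x\<bar> powr (p - 2) * u x"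

definition nbhd :: "'v set \<Rightarrow> 'v set" where
  "nbhd S = S \<union> E `` S"

lemma finite_nbhd: "finite S \<Longrightarrow> finite (nbhd S)"
  unfolding nbhd_def Image_eq_UN[of E S] using locally_finite by auto

lemma E_sym: "(x, y) \<in> E \<Longrightarrow> (y, x) \<in> E"
  using sym_E by (auto dest: symD)

text \<open>
  As a Euclidean norm, the gradient length inherits the triangle and Cauchy--Schwarz inequalities.
\<close>

lemma G_L2: "G u x = L2_set (\<lambda>y. sqrt (w x y / (2 * \<sigma> x)) * (u y - u x)) (E `` {x})"
proof -
  have "(sqrt (w x y / (2 * \<sigma> x)) * (u y - u x))\<^sup>2 = 1 / (2 * \<sigma> x) * (w x y * (u y - u x)\<^sup>2)"
    if "y \<in> E `` {x}" for y
    using weight_pos[of x y] sigma_pos[of x] that by (simp add: power_mult_distrib)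
  then show ?thesis by (simp add: grad_norm_def L2_set_def sum_distrib_left)
qed

lemma G_nonneg: "0 \<le> G u x"
  by (simp add: G_L2 L2_set_nonneg)

lemma G_sq: "(G u x)\<^sup>2 = grad_inner u u x"
proof -
  have "0 \<le> (\<Sum>y\<in>E `` {x}. w x y * (u y - u x)\<^sup>2)"
    using weight_pos[of x] by (intro sum_nonneg mult_nonneg_nonneg) (auto intro: less_imp_le)
  then show ?thesis
    using sigma_pos[of x] by (simp add: grad_norm_def grad_inner_def power2_eq_square)
qed

lemma grad_inner_le: "grad_inner u v x \<le> G u x * G v x"
proof -
  let ?a = "\<lambda>u y. sqrt (w x y / (2 * \<sigma> x)) * (u y - u x)"
  have "grad_inner u v x = (\<Sum>y\<in>E `` {x}. ?a u y * ?a v y)"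
  proof -
    have "1 / (2 * \<sigma> x) * (w x y * ((u y - u x) * (v y - v x))) = ?a u y * ?a v y"
      if "y \<in> E `` {x}" for y
    proof -
      have "?a u y * ?a v y = (sqrt (w x y / (2 * \<sigma> x)))\<^sup>2 * ((u y - u x) * (v y - v x))"
        unfolding power2_eq_square by (simp only: mult_ac)
      also have "(sqrt (w x y / (2 * \<sigma> x)))\<^sup>2 = w x y / (2 * \<sigma> x)"
        using weight_pos[of x y] sigma_pos[of x] that by (intro real_sqrt_pow2) auto
      finally show ?thesis by simp
    qed
    then show ?thesis by (simp add: grad_inner_def sum_distrib_left)
  qed
  also have "\<dots> \<le> (\<Sum>y\<in>E `` {x}. \<bar>?a u y\<bar> * \<bar>?a v y\<bar>)"
    by (intro sum_mono) (metis abs_ge_self abs_mult)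
  also have "\<dots> \<le> G u x * G v x"
    unfolding G_L2 by (rule L2_set_mult_ineq)
  finally show ?thesis .
qed

lemma G_triangle: "G (\<lambda>x. u x + v x) x \<le> G u x + G v x"
  using L2_set_triangle_ineq[of "\<lambda>y. sqrt (w x y / (2 * \<sigma> x)) * (u y - u x)"
      "\<lambda>y. sqrt (w x y / (2 * \<sigma> x)) * (v y - v x)" "E `` {x}"]
  by (simp add: G_L2 algebra_simps)

lemma G_scale: "G (\<lambda>x. c * u x) x = \<bar>c\<bar> * G u x"
proof -
  have "G (\<lambda>x. c * u x) x = L2_set (\<lambda>y. c * (sqrt (w x y / (2 * \<sigma> x)) * (u y - u x))) (E `` {x})"
    by (simp add: G_L2 algebra_simps)
  also have "\<dots> = sqrt (c\<^sup>2 * (\<Sum>y\<in>E `` {x}. (sqrt (w x y / (2 * \<sigma> x)) * (u y - u x))\<^sup>2))"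
    unfolding L2_set_def by (simp add: power_mult_distrib sum_distrib_left)
  also have "\<dots> = \<bar>c\<bar> * G u x" by (simp add: real_sqrt_mult G_L2 L2_set_def)
  finally show ?thesis .
qed

lemma G_parallelogram:
  "4 * (G (\<lambda>x. (u x + v x) / 2) x)\<^sup>2 + (G (\<lambda>x. u x - v x) x)\<^sup>2 = 2 * (G u x)\<^sup>2 + 2 * (G v x)\<^sup>2"
proof -
  have *: "4 * (w x y * (((u y + v y) / 2 - (u x + v x) / 2) * ((u y + v y) / 2 - (u x + v x) / 2)))
      + w x y * ((u y - v y - (u x - v x)) * (u y - v y - (u x - v x)))
    = 2 * (w x y * ((u y - u x) * (u y - u x))) + 2 * (w x y * ((v y - v x) * (v y - v x)))" for y
    by (simp add: field_simps)
  have "4 * grad_inner (\<lambda>x. (u x + v x) / 2) (\<lambda>x. (u x + v x) / 2) x + grad_inner (\<lambda>x. u x - v x) (\<lambda>x. u x - v x) x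
    = 1 / (2 * \<sigma> x) * (4 * (\<Sum>y\<in>E `` {x}. w x y * (((u y + v y) / 2 - (u x + v x) / 2) * ((u y + v y) / 2 - (u x + v x) / 2)))
      + (\<Sum>y\<in>E `` {x}. w x y * ((u y - v y - (u x - v x)) * (u y - v y - (u x - v x)))))"
    unfolding grad_inner_def by (simp add: algebra_simps)
  also have "\<dots> = 1 / (2 * \<sigma> x) * (2 * (\<Sum>y\<in>E `` {x}. w x y * ((u y - u x) * (u y - u x)))
      + 2 * (\<Sum>y\<in>E `` {x}. w x y * ((v y - v x) * (v y - v x))))"
    unfolding sum_distrib_left[of 4] sum_distrib_left[of 2] sum.distrib[symmetric] * ..
  also have "\<dots> = 2 * grad_inner u u x + 2 * grad_inner v v x"
    unfolding grad_inner_def by (simp add: algebra_simps)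
  finally show ?thesis by (simp add: G_sq)
qed

text \<open>
  The convention \<open>0 powr a = 0\<close> makes these identities hold at \<open>0\<close> for every \<open>p > 1\<close>, so that
  \<open>p < 2\<close> and \<open>p \<ge> 2\<close> are treated alike.
\<close>

lemma powr_minus2_mult: "0 \<le> a \<Longrightarrow> a powr (p - 2) * a\<^sup>2 = a powr p" for a :: real
proof (cases "a = 0")
  case False
  assume "0 \<le> a"
  have "a powr (p - 2) * a powr 2 = a powr (p - 2 + 2)" by (rule powr_add[symmetric])
  then show ?thesis using False \<open>0 \<le> a\<close> by simp
qed (use p in auto)

lemma powr_minus2_mult1: "0 \<le> a \<Longrightarrow> a powr (p - 2) * a = a powr (p - 1)" for a :: real
proof (cases "a = 0")
  case False
  assume "0 \<le> a"
  have "a powr (p - 2) * a powr 1 = a powr (p - 2 + 1)" by (rule powr_add[symmetric])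
  then show ?thesis using False \<open>0 \<le> a\<close> by simp
qed (use p in auto)

lemma G_convex: "G u x powr p + p * (G u x powr (p - 2) * grad_inner u (\<lambda>x. v x - u x) x) \<le> G v x powr p"
proof -
  have "grad_inner u (\<lambda>x. v x - u x) x = grad_inner u v x - grad_inner u u x"
    by (simp add: grad_inner_def algebra_simps sum_subtractf sum.distrib sum_distrib_left)
  also have "\<dots> \<le> G u x * (G v x - G u x)"
    using grad_inner_le[of u v x] G_sq[of u x] by (simp add: power2_eq_square algebra_simps)
  finally have "G u x powr (p - 2) * grad_inner u (\<lambda>x. v x - u x) x \<le> G u x powr (p - 2) * (G u x * (G v x - G u x))"
    by (intro mult_left_mono) auto
  also have "\<dots> = G u x powr (p - 1) * (G v x - G u x)"
    by (simp flip: powr_minus2_mult1[OF G_nonneg])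
  finally have "p * (G u x powr (p - 2) * grad_inner u (\<lambda>x. v x - u x) x) \<le> p * (G u x powr (p - 1) * (G v x - G u x))"
    using p by (intro mult_left_mono) auto
  then show ?thesis
    using powr_tangent[OF p G_nonneg[of u x] G_nonneg[of v x]] by simp
qed

lemma abs_powr_convex: "\<bar>a\<bar> powr p + p * (\<bar>a\<bar> powr (p - 2) * a * (b - a)) \<le> \<bar>b\<bar> powr p" for a b :: real
proof -
  have "a * (b - a) \<le> \<bar>a\<bar> * (\<bar>b\<bar> - \<bar>a\<bar>)"
    using abs_ge_self[of "a * b"] by (simp add: abs_mult right_diff_distrib)
  then have "\<bar>a\<bar> powr (p - 2) * (a * (b - a)) \<le> \<bar>a\<bar> powr (p - 2) * (\<bar>a\<bar> * (\<bar>b\<bar> - \<bar>a\<bar>))"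
    by (intro mult_left_mono) auto
  also have "\<dots> = \<bar>a\<bar> powr (p - 1) * (\<bar>b\<bar> - \<bar>a\<bar>)"
    by (simp flip: powr_minus2_mult1)
  finally have "p * (\<bar>a\<bar> powr (p - 2) * (a * (b - a))) \<le> p * (\<bar>a\<bar> powr (p - 1) * (\<bar>b\<bar> - \<bar>a\<bar>))"
    using p by (intro mult_left_mono) auto
  then show ?thesis
    using powr_tangent[OF p, of "\<bar>a\<bar>" "\<bar>b\<bar>"] by (simp add: mult.assoc)
qed

lemma G_zero_off:
  assumes "\<And>x. x \<notin> S \<Longrightarrow> u x = 0" "x \<notin> nbhd S"
  shows "G u x = 0"
proof -
  have "u y = 0" if "y \<in> E `` {x}" for y
    using assms that E_sym[of x y] by (auto simp: nbhd_def Image_iff)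
  moreover have "u x = 0" using assms by (auto simp: nbhd_def)
  ultimately show ?thesis by (simp add: grad_norm_def)
qed

lemma energy_eq_sum:
  assumes "finite S" "\<And>x. x \<notin> S \<Longrightarrow> u x = 0"
  shows "energy u = (\<Sum>x\<in>nbhd S. \<sigma> x * (G u x powr p + \<rho> x * \<bar>u x\<bar> powr p))"
proof -
  have "energy u = infsum (\<lambda>x. \<sigma> x * (G u x powr p + \<rho> x * \<bar>u x\<bar> powr p)) (nbhd S)"
    unfolding energy_def vint_def
    using G_zero_off[OF assms(2)] assms(2) p by (intro infsum_cong_neutral) (auto simp: nbhd_def)
  then show ?thesis using finite_nbhd[OF assms(1)] by simp
qed

lemma energy_nonneg: "0 \<le> energy u"
  unfolding energy_def vint_def
  by (intro infsum_nonneg mult_nonneg_nonneg add_nonneg_nonneg) (auto simp: rho_nonneg less_imp_le sigma_pos)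

lemma energy_scale:
  assumes "finite S" "\<And>x. x \<notin> S \<Longrightarrow> u x = 0"
  shows "energy (\<lambda>x. c * u x) = \<bar>c\<bar> powr p * energy u"
proof -
  have "energy (\<lambda>x. c * u x) = (\<Sum>x\<in>nbhd S. \<sigma> x * (G (\<lambda>x. c * u x) x powr p + \<rho> x * \<bar>c * u x\<bar> powr p))"
    using assms by (intro energy_eq_sum) auto
  also have "\<dots> = (\<Sum>x\<in>nbhd S. \<bar>c\<bar> powr p * (\<sigma> x * (G u x powr p + \<rho> x * \<bar>u x\<bar> powr p)))"
    by (intro sum.cong) (auto simp: G_scale abs_mult powr_mult G_nonneg algebra_simps)
  finally show ?thesis by (simp add: energy_eq_sum[OF assms] sum_distrib_left)
qed

text \<open>
  Summation by parts: in the double sum over edges, the terms with \<open>\<phi> y\<close> and those with \<open>\<phi> x\<close> are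
  exchanged by the symmetry of the weights. On the left the sum
  runs over the neighbourhood of \<open>S\<close>, because the gradient of \<open>\<phi>\<close> reaches one edge further than
  \<open>\<phi>\<close>.
\<close>

lemma p_laplacian_by_parts:
  assumes S: "finite S" and \<phi>: "\<And>x. x \<notin> S \<Longrightarrow> \<phi> x = 0"
  shows "(\<Sum>x\<in>nbhd S. \<sigma> x * (G u x powr (p - 2) * grad_inner u \<phi> x)) =
    (\<Sum>x\<in>S. \<sigma> x * (- p_laplacian E w \<sigma> p u x) * \<phi> x)"
proof -
  define W where "W = nbhd S"
  define k where "k x y = (if (x, y) \<in> E then w x y else 0)" for x y
  define f where "f x = G u x powr (p - 2)" for x
  have W: "finite W" "S \<subseteq> W" using finite_nbhd[OF S] by (auto simp: W_def nbhd_def)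
  have ksym: "k x y = k y x" for x y using weight_sym E_sym by (auto simp: k_def)
  have "\<sigma> x * (f x * grad_inner u \<phi> x) = (\<Sum>y\<in>W. k x y * (f x * (u y - u x) * \<phi> y) / 2) -
      (\<Sum>y\<in>W. k x y * (f x * (u y - u x) * \<phi> x) / 2)" if x: "x \<in> W" for x
  proof -
    have "(\<Sum>y\<in>E `` {x}. w x y * ((u y - u x) * (\<phi> y - \<phi> x))) =
        (\<Sum>y\<in>W. k x y * ((u y - u x) * (\<phi> y - \<phi> x)))"
    proof (rule sum.mono_neutral_cong)
      show "w x y * ((u y - u x) * (\<phi> y - \<phi> x)) = 0" if "y \<in> E `` {x} - W" for y
      proof -
        have "y \<notin> S" "x \<notin> S" using that by (auto simp: W_def nbhd_def)
        then show ?thesis using \<phi> by simp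
      qed
    qed (use W locally_finite in \<open>auto simp: k_def\<close>)
    then have "\<sigma> x * (f x * grad_inner u \<phi> x) = f x / 2 * (\<Sum>y\<in>W. k x y * ((u y - u x) * (\<phi> y - \<phi> x)))"
      using sigma_pos[of x] by (simp add: grad_inner_def)
    also have "\<dots> = (\<Sum>y\<in>W. k x y * (f x * (u y - u x) * \<phi> y) / 2 - k x y * (f x * (u y - u x) * \<phi> x) / 2)"
      unfolding sum_distrib_left by (intro sum.cong refl) (simp add: algebra_simps diff_divide_distrib)
    finally show ?thesis by (simp add: sum_subtractf)
  qed
  then have "(\<Sum>x\<in>W. \<sigma> x * (f x * grad_inner u \<phi> x)) =
      (\<Sum>x\<in>W. \<Sum>y\<in>W. k x y * (f x * (u y - u x) * \<phi> y) / 2) -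
      (\<Sum>x\<in>W. \<Sum>y\<in>W. k x y * (f x * (u y - u x) * \<phi> x) / 2)"
    by (simp add: sum_subtractf)
  also have "(\<Sum>x\<in>W. \<Sum>y\<in>W. k x y * (f x * (u y - u x) * \<phi> y) / 2) =
      (\<Sum>x\<in>W. \<Sum>y\<in>W. k x y * (f y * (u x - u y) * \<phi> x) / 2)"
    by (subst sum.swap) (simp add: ksym)
  also have "\<dots> - (\<Sum>x\<in>W. \<Sum>y\<in>W. k x y * (f x * (u y - u x) * \<phi> x) / 2) =
      (\<Sum>x\<in>W. - (\<Sum>y\<in>W. (f x + f y) / 2 * k x y * (u y - u x)) * \<phi> x)"
    unfolding sum_subtractf[symmetric] sum_negf[symmetric] sum_distrib_right
    by (intro sum.cong refl) (simp add: field_simps)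
  also have "\<dots> = (\<Sum>x\<in>S. - (\<Sum>y\<in>W. (f x + f y) / 2 * k x y * (u y - u x)) * \<phi> x)"
    using W \<phi> by (intro sum.mono_neutral_right) auto
  also have "\<dots> = (\<Sum>x\<in>S. \<sigma> x * (- p_laplacian E w \<sigma> p u x) * \<phi> x)"
  proof (rule sum.cong)
    fix x assume x: "x \<in> S"
    have "(\<Sum>y\<in>W. (f x + f y) / 2 * k x y * (u y - u x)) =
        (\<Sum>y\<in>E `` {x}. (f x + f y) / 2 * w x y * (u y - u x))"
      using W x by (intro sum.mono_neutral_cong_right) (auto simp: k_def W_def nbhd_def)
    then show "- (\<Sum>y\<in>W. (f x + f y) / 2 * k x y * (u y - u x)) * \<phi> x = \<sigma> x * (- p_laplacian E w \<sigma> p u x) * \<phi> x"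
      using sigma_pos[of x] by (simp add: p_laplacian_def f_def)
  qed simp
  finally show ?thesis by (simp add: W_def f_def)
qed

text \<open>
  The gradient inequality of a convex function, the gradient of \<open>energy / p\<close> at \<open>u\<close> being
  \<open>\<sigma> x * L u x\<close>. It plays the part of differentiability of the energy in the descent estimate for
  \<open>J\<close>.
\<close>

lemma energy_convex:
  assumes S: "finite S" and u: "\<And>x. x \<notin> S \<Longrightarrow> u x = 0" and v: "\<And>x. x \<notin> S \<Longrightarrow> v x = 0"
  shows "energy u + p * (\<Sum>x\<in>S. \<sigma> x * L u x * (v x - u x)) \<le> energy v"
proof -
  let ?d = "\<lambda>x. v x - u x"
  have sub: "S \<subseteq> nbhd S" by (auto simp: nbhd_def)
  have "(\<Sum>x\<in>S. \<sigma> x * L u x * ?d x) = (\<Sum>x\<in>S. \<sigma> x * (- p_laplacian E w \<sigma> p u x) * ?d x)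
      + (\<Sum>x\<in>S. \<sigma> x * (\<rho> x * (\<bar>u x\<bar> powr (p - 2) * u x * ?d x)))"
    unfolding sum.distrib[symmetric] by (intro sum.cong refl) (simp add: L_def algebra_simps)
  also have "(\<Sum>x\<in>S. \<sigma> x * (\<rho> x * (\<bar>u x\<bar> powr (p - 2) * u x * ?d x))) =
      (\<Sum>x\<in>nbhd S. \<sigma> x * (\<rho> x * (\<bar>u x\<bar> powr (p - 2) * u x * ?d x)))"
    using finite_nbhd[OF S] sub u by (intro sum.mono_neutral_left) (auto simp: u)
  also have "(\<Sum>x\<in>S. \<sigma> x * (- p_laplacian E w \<sigma> p u x) * ?d x) =
      (\<Sum>x\<in>nbhd S. \<sigma> x * (G u x powr (p - 2) * grad_inner u ?d x))"
    using S by (intro p_laplacian_by_parts[symmetric]) (auto simp: u v)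
  finally have "energy u + p * (\<Sum>x\<in>S. \<sigma> x * L u x * ?d x) = (\<Sum>x\<in>nbhd S. \<sigma> x * (
      (G u x powr p + p * (G u x powr (p - 2) * grad_inner u ?d x)) +
      \<rho> x * (\<bar>u x\<bar> powr p + p * (\<bar>u x\<bar> powr (p - 2) * u x * ?d x))))"
    by (simp add: energy_eq_sum[OF S u] sum_distrib_left sum.distrib[symmetric] algebra_simps)
  also have "\<dots> \<le> (\<Sum>x\<in>nbhd S. \<sigma> x * (G v x powr p + \<rho> x * \<bar>v x\<bar> powr p))"
    using sigma_pos rho_nonneg
    by (intro sum_mono mult_left_mono add_mono G_convex abs_powr_convex) (auto intro: less_imp_le)
  finally show ?thesis by (simp add: energy_eq_sum[OF S v])
qed

lemma energy_eq_pairing: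
  assumes S: "finite S" and u: "\<And>x. x \<notin> S \<Longrightarrow> u x = 0"
  shows "energy u = (\<Sum>x\<in>S. \<sigma> x * L u x * u x)"
proof -
  have sub: "S \<subseteq> nbhd S" by (auto simp: nbhd_def)
  have sq: "\<bar>a\<bar> powr (p - 2) * a * a = \<bar>a\<bar> powr p" for a :: real
    using powr_minus2_mult[of "\<bar>a\<bar>"] by (simp add: power2_eq_square)
  have "(\<Sum>x\<in>S. \<sigma> x * L u x * u x) = (\<Sum>x\<in>S. \<sigma> x * (- p_laplacian E w \<sigma> p u x) * u x)
      + (\<Sum>x\<in>S. \<sigma> x * (\<rho> x * (\<bar>u x\<bar> powr (p - 2) * u x * u x)))"
    unfolding sum.distrib[symmetric] by (intro sum.cong refl) (simp add: L_def algebra_simps)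
  also have "(\<Sum>x\<in>S. \<sigma> x * (\<rho> x * (\<bar>u x\<bar> powr (p - 2) * u x * u x))) =
      (\<Sum>x\<in>nbhd S. \<sigma> x * (\<rho> x * (\<bar>u x\<bar> powr (p - 2) * u x * u x)))"
    using finite_nbhd[OF S] sub u by (intro sum.mono_neutral_left) auto
  also have "(\<Sum>x\<in>S. \<sigma> x * (- p_laplacian E w \<sigma> p u x) * u x) =
      (\<Sum>x\<in>nbhd S. \<sigma> x * (G u x powr (p - 2) * grad_inner u u x))"
    using S by (intro p_laplacian_by_parts[symmetric]) (auto simp: u)
  finally show ?thesis
    by (simp add: energy_eq_sum[OF S u] sq powr_minus2_mult G_nonneg flip: G_sq sum.distrib)
      (simp add: algebra_simps)
qed

lemma G_tendsto:
  assumes "\<And>x. ((\<lambda>i. U i x) \<longlongrightarrow> u x) F"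
  shows "((\<lambda>i. G (U i) x) \<longlongrightarrow> G u x) F"
  unfolding grad_norm_def by (intro tendsto_intros assms)

lemma G_edge:
  assumes "(x, y) \<in> E"
  obtains K where "K > 0" "\<And>u. \<bar>u y - u x\<bar> \<le> K * G u x"
proof -
  define c where "c = sqrt (w x y / (2 * \<sigma> x))"
  have c: "c > 0" using weight_pos[OF assms] sigma_pos[of x] by (simp add: c_def)
  have "c * \<bar>u y - u x\<bar> \<le> G u x" for u
    using member_le_L2_set[of "E `` {x}" y "\<lambda>y. sqrt (w x y / (2 * \<sigma> x)) * \<bar>u y - u x\<bar>"]
      locally_finite[of x] assms by (simp add: G_L2 c_def L2_set_def power_mult_distrib)
  then have "\<bar>u y - u x\<bar> \<le> 1 / c * G u x" for u
    using c by (simp add: field_simps)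
  then show ?thesis using that[of "1 / c"] c by simp
qed

text \<open>
  The only delicate point in the continuity of \<open>L\<close>: for \<open>p < 2\<close> the factor \<open>g powr (p - 2)\<close> blows up
  where \<open>g\<close> tends to \<open>0\<close>, but the increment \<open>d\<close> that it multiplies is dominated by \<open>g\<close>, so that the
  product is of order \<open>g powr (p - 1)\<close>.
\<close>

lemma powr_minus2_tendsto:
  fixes g d :: "'i \<Rightarrow> real"
  assumes g: "(g \<longlongrightarrow> a) F" "\<And>i. 0 \<le> g i" and d: "(d \<longlongrightarrow> b) F"
    and K: "\<And>i. \<bar>d i\<bar> \<le> K * g i" "\<bar>b\<bar> \<le> K * a" and a: "0 \<le> a"
  shows "((\<lambda>i. g i powr (p - 2) * d i) \<longlongrightarrow> a powr (p - 2) * b) F"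
proof (cases "a = 0")
  case False
  then show ?thesis by (intro tendsto_intros g d) auto
next
  case True
  have "((\<lambda>i. K * g i powr (p - 1)) \<longlongrightarrow> K * a powr (p - 1)) F"
    using g p by (intro tendsto_intros) auto
  then have "((\<lambda>i. K * g i powr (p - 1)) \<longlongrightarrow> 0) F" using True by simp
  moreover have "\<bar>g i powr (p - 2) * d i\<bar> \<le> K * g i powr (p - 1)" for i
  proof -
    have "\<bar>g i powr (p - 2) * d i\<bar> \<le> g i powr (p - 2) * (K * g i)"
      using K(1)[of i] by (simp add: abs_mult mult_left_mono)
    also have "\<dots> = K * g i powr (p - 1)"
      using powr_minus2_mult1[OF g(2)[of i]] by (simp add: algebra_simps)
    finally show ?thesis .
  qed
  ultimately have "((\<lambda>i. g i powr (p - 2) * d i) \<longlongrightarrow> 0) F"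
    by (intro Lim_null_comparison[of "\<lambda>i. g i powr (p - 2) * d i" "\<lambda>i. K * g i powr (p - 1)"]) auto
  then show ?thesis using True by simp
qed

lemma L_tendsto:
  assumes U: "\<And>x. ((\<lambda>i. U i x) \<longlongrightarrow> u x) F"
  shows "((\<lambda>i. L (U i) x) \<longlongrightarrow> L u x) F"
proof -
  have edge: "((\<lambda>i. (G (U i) x powr (p - 2) + G (U i) y powr (p - 2)) / 2 * w x y * (U i y - U i x)) \<longlongrightarrow>
      (G u x powr (p - 2) + G u y powr (p - 2)) / 2 * w x y * (u y - u x)) F" if xy: "y \<in> E `` {x}" for y
  proof -
    obtain K1 where K1: "\<And>u. \<bar>u y - u x\<bar> \<le> K1 * G u x" using G_edge[of x y] xy by blast
    obtain K2 where "\<And>u. \<bar>u x - u y\<bar> \<le> K2 * G u y" using G_edge[of y x] E_sym xy by blast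
    then have K2: "\<And>u. \<bar>u y - u x\<bar> \<le> K2 * G u y" by (simp add: abs_minus_commute)
    have "((\<lambda>i. G (U i) x powr (p - 2) * (U i y - U i x)) \<longlongrightarrow> G u x powr (p - 2) * (u y - u x)) F"
      by (rule powr_minus2_tendsto[where K = K1]) (auto intro!: G_tendsto U tendsto_diff K1 G_nonneg)
    moreover have "((\<lambda>i. G (U i) y powr (p - 2) * (U i y - U i x)) \<longlongrightarrow> G u y powr (p - 2) * (u y - u x)) F"
      by (rule powr_minus2_tendsto[where K = K2]) (auto intro!: G_tendsto U tendsto_diff K2 G_nonneg)
    ultimately have "((\<lambda>i. (G (U i) x powr (p - 2) * (U i y - U i x) + G (U i) y powr (p - 2) * (U i y - U i x)) * (w x y / 2)) \<longlongrightarrow>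
      (G u x powr (p - 2) * (u y - u x) + G u y powr (p - 2) * (u y - u x)) * (w x y / 2)) F"
      by (rule tendsto_mult_right[OF tendsto_add])
    then show ?thesis by (simp add: algebra_simps add_divide_distrib diff_divide_distrib)
  qed
  have "((\<lambda>i. \<bar>U i x\<bar> powr (p - 2) * U i x) \<longlongrightarrow> \<bar>u x\<bar> powr (p - 2) * u x) F"
    by (rule powr_minus2_tendsto[where K = 1]) (auto intro!: tendsto_intros U)
  then have "((\<lambda>i. \<rho> x * (\<bar>U i x\<bar> powr (p - 2) * U i x)) \<longlongrightarrow> \<rho> x * (\<bar>u x\<bar> powr (p - 2) * u x)) F"
    by (rule tendsto_mult_left)
  moreover have "((\<lambda>i. p_laplacian E w \<sigma> p (U i) x) \<longlongrightarrow> p_laplacian E w \<sigma> p u x) F"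
    unfolding p_laplacian_def by (intro tendsto_mult_left tendsto_sum edge)
  ultimately show ?thesis
    unfolding L_def mult.assoc[of "\<rho> x"] by (intro tendsto_add tendsto_minus)
qed

lemma energy_continuous:
  assumes S: "finite S"
  shows "ptw_continuous_on (cube S R) energy"
  unfolding ptw_continuous_on_def
proof (intro allI impI)
  fix U :: "nat \<Rightarrow> 'v \<Rightarrow> real" and u
  assume U: "\<forall>n. U n \<in> cube S R" "u \<in> cube S R" "\<forall>x. (\<lambda>n. U n x) \<longlonglongrightarrow> u x"
  have "energy (U n) = (\<Sum>x\<in>nbhd S. \<sigma> x * (G (U n) x powr p + \<rho> x * \<bar>U n x\<bar> powr p))" for n
    using U by (intro energy_eq_sum S) (auto simp: cube_def)
  moreover have "energy u = (\<Sum>x\<in>nbhd S. \<sigma> x * (G u x powr p + \<rho> x * \<bar>u x\<bar> powr p))"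
    using U by (intro energy_eq_sum S) (auto simp: cube_def)
  moreover have "(\<lambda>n. \<Sum>x\<in>nbhd S. \<sigma> x * (G (U n) x powr p + \<rho> x * \<bar>U n x\<bar> powr p)) \<longlonglongrightarrow>
    (\<Sum>x\<in>nbhd S. \<sigma> x * (G u x powr p + \<rho> x * \<bar>u x\<bar> powr p))"
    by (intro tendsto_sum tendsto_mult_left tendsto_add tendsto_powr' tendsto_rabs G_tendsto tendsto_const
        U(3)[rule_format] disjI2 conjI always_eventually allI G_nonneg abs_ge_zero) (use p in auto)
  ultimately show "(\<lambda>n. energy (U n)) \<longlonglongrightarrow> energy u" by (simp only:)
qed

text \<open>
  The inequality for four numbers is applied at each vertex to the gradients and to the values, and
  summed up.
\<close>

lemma energy_uniform_convexity:
  assumes eps: "\<epsilon> > 0"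
  obtains K where "K > 0" "\<And>u v. u \<in> fin_supp \<Longrightarrow> v \<in> fin_supp \<Longrightarrow>
    energy (\<lambda>x. u x - v x) \<le> \<epsilon> * (energy u + energy v) +
      K * ((energy u + energy v) / 2 - energy (\<lambda>x. (u x + v x) / 2))"
proof -
  obtain K where K0: "K > 0 \<and> (\<forall>A\<ge>0. \<forall>B\<ge>0. \<forall>M\<ge>0. \<forall>D\<ge>0.
    4 * M\<^sup>2 + D\<^sup>2 = 2 * A\<^sup>2 + 2 * B\<^sup>2 \<longrightarrow> 2 * M \<le> A + B \<longrightarrow>
    D powr p \<le> \<epsilon> * (A powr p + B powr p) + K * ((A powr p + B powr p) / 2 - M powr p))"
    using powr_uniform_convexity[OF p eps] ..
  note Kpos = K0[THEN conjunct1] and K = K0[THEN conjunct2, rule_format]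
  show ?thesis
  proof (rule that[of K, OF Kpos])
    fix u v :: "'v \<Rightarrow> real"
    assume uv: "u \<in> fin_supp" "v \<in> fin_supp"
    define S where "S = {x. u x \<noteq> 0} \<union> {x. v x \<noteq> 0}"
    have S: "finite S" using uv by (simp add: S_def fin_supp_def)
    define e where "e u x = G u x powr p + \<rho> x * \<bar>u x\<bar> powr p" for u x
    let ?d = "\<lambda>x. u x - v x" and ?m = "\<lambda>x. (u x + v x) / 2"
    have en: "energy f = (\<Sum>x\<in>nbhd S. \<sigma> x * e f x)" if "\<And>x. x \<notin> S \<Longrightarrow> f x = 0" for f
      unfolding e_def using S that by (rule energy_eq_sum)
    have ens: "energy u = (\<Sum>x\<in>nbhd S. \<sigma> x * e u x)" "energy v = (\<Sum>x\<in>nbhd S. \<sigma> x * e v x)"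
      "energy ?d = (\<Sum>x\<in>nbhd S. \<sigma> x * e ?d x)" "energy ?m = (\<Sum>x\<in>nbhd S. \<sigma> x * e ?m x)"
      by (rule en; simp add: S_def)+
    have pt: "e ?d x \<le> \<epsilon> * (e u x + e v x) + K * ((e u x + e v x) / 2 - e ?m x)" for x
    proof -
      have "2 * G ?m x \<le> G u x + G v x"
        using G_scale[of 2 ?m x] G_triangle[of u v x] by (simp add: add_divide_distrib)
      then have 1: "G ?d x powr p \<le> \<epsilon> * (G u x powr p + G v x powr p)
          + K * ((G u x powr p + G v x powr p) / 2 - G ?m x powr p)"
        by (intro K G_nonneg G_parallelogram)
      have 2: "\<bar>?d x\<bar> powr p \<le> \<epsilon> * (\<bar>u x\<bar> powr p + \<bar>v x\<bar> powr p)
          + K * ((\<bar>u x\<bar> powr p + \<bar>v x\<bar> powr p) / 2 - \<bar>?m x\<bar> powr p)"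
        by (intro K) (auto simp: power2_eq_square field_simps)
      show ?thesis
        using 1 mult_left_mono[OF 2 rho_nonneg[of x]] by (simp add: e_def algebra_simps add_divide_distrib)
    qed
    have "energy ?d \<le> (\<Sum>x\<in>nbhd S. \<sigma> x * (\<epsilon> * (e u x + e v x) + K * ((e u x + e v x) / 2 - e ?m x)))"
      unfolding ens by (intro sum_mono mult_left_mono pt less_imp_le sigma_pos)
    also have "\<dots> = \<epsilon> * (energy u + energy v) + K * ((energy u + energy v) / 2 - energy ?m)"
      unfolding ens
      by (simp add: sum_distrib_left sum_divide_distrib sum.distrib[symmetric] sum_subtractf[symmetric]
          algebra_simps add_divide_distrib)
    finally show "energy ?d \<le> \<epsilon> * (energy u + energy v) + K * ((energy u + energy v) / 2 - energy ?m)" .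
  qed
qed

section \<open>The completion and its first eigenvalue\<close>

lemma Hp_norm_eq: "Hp_norm E w \<sigma> \<rho> p u = energy u powr (1 / p)"
  by (simp add: Hp_norm_def energy_def)

lemma fin_supp_subset_Hp: "u \<in> fin_supp \<Longrightarrow> u \<in> Hp_space E w \<sigma> \<rho> p"
proof -
  assume u: "u \<in> fin_supp"
  have "energy (\<lambda>x. 0) = 0"
    by (simp add: energy_def vint_def grad_norm_def)
  then show ?thesis
    using u unfolding Hp_space_def by (auto simp: Hp_norm_eq intro!: exI[of _ "\<lambda>_. u"])
qed

text \<open>
  Finitely supported functions are admissible in the infimum that defines the eigenvalue.
\<close>

lemma lambda_p_le:
  assumes S: "finite S" and u: "\<And>x. x \<notin> S \<Longrightarrow> u x = 0"
  shows "lambda_p E w \<sigma> \<rho> p * (\<Sum>x\<in>S. \<sigma> x * \<bar>u x\<bar> powr p) \<le> energy u"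
proof (cases "\<exists>x. u x \<noteq> 0")
  case False
  then show ?thesis using energy_nonneg[of u] by simp
next
  case True
  define N where "N = (\<Sum>x\<in>S. \<sigma> x * \<bar>u x\<bar> powr p)"
  obtain x where x: "u x \<noteq> 0" using True by blast
  have "x \<in> S" using x u by blast
  have "0 < \<sigma> x * \<bar>u x\<bar> powr p" using x sigma_pos by simp
  also have "\<dots> \<le> N" unfolding N_def
    using \<open>x \<in> S\<close> S by (intro member_le_sum mult_nonneg_nonneg less_imp_le[OF sigma_pos]) auto
  finally have N: "N > 0" .
  have "vint \<sigma> (\<lambda>x. \<bar>u x\<bar> powr p) = infsum (\<lambda>x. \<sigma> x * \<bar>u x\<bar> powr p) S"
    unfolding vint_def using u p by (intro infsum_cong_neutral) auto
  then have lp: "lp_norm \<sigma> p u powr p = N"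
    using S N p by (simp add: lp_norm_def N_def powr_powr)
  have hp: "Hp_norm E w \<sigma> \<rho> p v powr p = energy v" for v
    using p energy_nonneg[of v] by (simp add: Hp_norm_eq powr_powr)
  have "finite {x. u x \<noteq> 0}" using S u by (rule_tac finite_subset[of _ S]) auto
  then have "u \<in> {u \<in> Hp_space E w \<sigma> \<rho> p. \<exists>x. u x \<noteq> 0}"
    using True fin_supp_subset_Hp by (auto simp: fin_supp_def)
  then have "lambda_p E w \<sigma> \<rho> p \<le> Hp_norm E w \<sigma> \<rho> p u powr p / lp_norm \<sigma> p u powr p"
    unfolding lambda_p_def by (intro cINF_lower bdd_belowI2[of _ 0]) auto
  then show ?thesis using N by (simp add: lp hp N_def[symmetric] field_simps)
qed

text \<open>
  The functions \<open>U n\<close> themselves need not form a Cauchy sequence, and truncations of \<open>u\<close> need not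
  have small energy differences, as vertex degrees and weights are unbounded. Instead, let \<open>C N\<close> be
  the convex set of finitely supported functions that are close to \<open>u\<close> on \<open>A N\<close>. The infima of the
  energy over the shrinking sets \<open>C N\<close> increase and stay below \<open>B\<close>, hence converge. Means of
  near-minimisers lie in \<open>C N\<close> again, so their energy is not much smaller, and uniform convexity turns
  this into the Cauchy property.
\<close>

lemma bounded_energy_limit_in_Hp:
  fixes A :: "nat \<Rightarrow> 'v set"
  assumes A: "\<And>N. finite (A N)" "incseq A" "(\<Union>N. A N) = UNIV"
    and U: "\<And>n. U n \<in> fin_supp" "\<And>n. energy (U n) \<le> B"
    and lim: "\<And>x. (\<lambda>n. U n x) \<longlonglongrightarrow> u x"
  shows "u \<in> Hp_space E w \<sigma> \<rho> p"
proof -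
  define C where "C N = {v \<in> fin_supp. \<forall>x\<in>A N. \<bar>v x - u x\<bar> \<le> inverse (real (Suc N))}" for N
  have Cmono: "C M \<subseteq> C N" if "N \<le> M" for M N
  proof -
    have inv: "inverse (real (Suc M)) \<le> inverse (real (Suc N))" using that by (simp add: field_simps)
    have sub: "A N \<subseteq> A M" using A(2) that by (simp add: incseq_def)
    show ?thesis
    proof
      fix v assume v: "v \<in> C M"
      have "\<bar>v x - u x\<bar> \<le> inverse (real (Suc N))" if "x \<in> A N" for x
      proof -
        have "\<bar>v x - u x\<bar> \<le> inverse (real (Suc M))" using v that sub by (auto simp: C_def)
        then show ?thesis using inv by linarith
      qed
      then show "v \<in> C N" using v by (auto simp: C_def)
    qed
  qed
  have nonempty: "\<exists>v\<in>C N. energy v \<le> B" for N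
  proof -
    have "\<forall>\<^sub>F n in sequentially. \<bar>U n x - u x\<bar> < inverse (real (Suc N))" for x
      using tendstoD[OF lim[of x], of "inverse (real (Suc N))"] by (simp add: dist_real_def)
    then have "\<forall>\<^sub>F n in sequentially. \<forall>x\<in>A N. \<bar>U n x - u x\<bar> < inverse (real (Suc N))"
      using A(1) by (intro eventually_ball_finite) auto
    then obtain n where "\<forall>x\<in>A N. \<bar>U n x - u x\<bar> < inverse (real (Suc N))"
      using eventually_happens'[OF sequentially_bot] by blast
    then have "U n \<in> C N" using U by (auto simp: C_def less_imp_le)
    then show ?thesis using U by blast
  qed
  define d where "d N = Inf (energy ` C N)" for N
  have bdd: "bdd_below (energy ` C N)" for N by (intro bdd_belowI2[of _ 0] energy_nonneg)
  have d_le: "d N \<le> energy v" if "v \<in> C N" for v N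
    unfolding d_def using bdd that by (rule cINF_lower)
  have dB: "d N \<le> B" for N using nonempty[of N] d_le[of _ N] by force
  have dmono: "incseq d"
    unfolding incseq_def
  proof (intro allI impI)
    fix M N :: nat assume "M \<le> N"
    moreover obtain v where "v \<in> C N" using nonempty[of N] by blast
    ultimately show "d M \<le> d N"
      unfolding d_def by (intro cINF_superset_mono bdd Cmono) auto
  qed
  obtain D where D: "d \<longlonglongrightarrow> D" "\<And>N. d N \<le> D"
    using incseq_convergent[OF dmono] dB by blast
  have "\<exists>v\<in>C N. energy v < d N + inverse (real (Suc N))" for N
  proof -
    have "energy ` C N \<noteq> {}" using nonempty[of N] by blast
    then show ?thesis
      unfolding d_def by (subst cInf_less_iff[OF _ bdd, symmetric, of N, simplified]) auto
  qed
  then obtain V where V: "\<And>N. V N \<in> C N" "\<And>N. energy (V N) < d N + inverse (real (Suc N))"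
    by metis
  have VD: "energy (V n) \<le> D + inverse (real (Suc N))" if "N \<le> n" for n N
  proof -
    have "inverse (real (Suc n)) \<le> inverse (real (Suc N))" using that by (simp add: field_simps)
    then show ?thesis using V(2)[of n] D(2)[of n] by linarith
  qed
  have mid: "d N \<le> energy (\<lambda>x. (V m x + V n x) / 2)" if "N \<le> m" "N \<le> n" for m n N
  proof -
    have mn: "V m \<in> C N" "V n \<in> C N" using Cmono that V(1) by blast+
    have "{x. (V m x + V n x) / 2 \<noteq> 0} \<subseteq> {x. V m x \<noteq> 0} \<union> {x. V n x \<noteq> 0}" by auto
    then have "(\<lambda>x. (V m x + V n x) / 2) \<in> fin_supp"
      using mn by (auto simp: C_def fin_supp_def intro: finite_subset)
    moreover have "\<bar>(V m x + V n x) / 2 - u x\<bar> \<le> inverse (real (Suc N))" if "x \<in> A N" for x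
    proof -
      have mean: "\<bar>(a + b) / 2 - c\<bar> \<le> i" if "\<bar>a - c\<bar> \<le> i" "\<bar>b - c\<bar> \<le> i" for a b c i :: real
        using that by (auto simp: abs_le_iff field_simps)
      show ?thesis using mn that by (intro mean) (auto simp: C_def)
    qed
    ultimately show ?thesis by (intro d_le) (auto simp: C_def)
  qed
  have D0: "0 \<le> D" using D(2)[of 0] d_def[of 0] nonempty[of 0]
    by (metis cINF_greatest empty_iff energy_nonneg order_trans)
  have cauchy: "\<exists>N. \<forall>m\<ge>N. \<forall>n\<ge>N. energy (\<lambda>x. V m x - V n x) < \<eta>" if \<eta>: "\<eta> > 0" for \<eta>
  proof -
    define \<epsilon> where "\<epsilon> = \<eta> / (4 * (D + 1))"
    have eps: "\<epsilon> > 0" using \<eta> D0 by (simp add: \<epsilon>_def)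
    obtain K where K: "K > 0" "\<And>u v. u \<in> fin_supp \<Longrightarrow> v \<in> fin_supp \<Longrightarrow>
      energy (\<lambda>x. u x - v x) \<le> \<epsilon> * (energy u + energy v) +
      K * ((energy u + energy v) / 2 - energy (\<lambda>x. (u x + v x) / 2))"
      using energy_uniform_convexity[OF eps] by blast
    have "(\<lambda>N. D + inverse (real (Suc N)) - d N) \<longlonglongrightarrow> D + 0 - D"
      by (intro tendsto_intros LIMSEQ_inverse_real_of_nat D)
    then have "\<forall>\<^sub>F N in sequentially. D + inverse (real (Suc N)) - d N < \<eta> / (2 * K)"
      using \<eta> K(1) by (intro order_tendstoD) auto
    then obtain N where N: "D + inverse (real (Suc N)) - d N < \<eta> / (2 * K)"
      using eventually_happens'[OF sequentially_bot] by blast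
    have "energy (\<lambda>x. V m x - V n x) < \<eta>" if mn: "N \<le> m" "N \<le> n" for m n
    proof -
      define i where "i = inverse (real (Suc N))"
      have i1: "i \<le> 1" by (simp add: i_def field_simps)
      have e: "energy (V m) \<le> D + i" "energy (V n) \<le> D + i"
        using VD mn unfolding i_def by auto
      have "energy (\<lambda>x. V m x - V n x) \<le> \<epsilon> * (energy (V m) + energy (V n)) +
        K * ((energy (V m) + energy (V n)) / 2 - energy (\<lambda>x. (V m x + V n x) / 2))"
        using V(1) by (intro K(2)) (auto simp: C_def)
      also have "\<dots> \<le> \<epsilon> * (2 * (D + 1)) + K * (D + i - d N)"
      proof (intro add_mono mult_left_mono)
        show "energy (V m) + energy (V n) \<le> 2 * (D + 1)" using e i1 unfolding distrib_left by linarith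
        have "(a + b) / 2 - c \<le> q - r" if "a \<le> q" "b \<le> q" "r \<le> c" for a b c q r :: real
          using that unfolding add_divide_distrib by linarith
        then show "(energy (V m) + energy (V n)) / 2 - energy (\<lambda>x. (V m x + V n x) / 2) \<le>
            D + i - d N" using e mid[OF mn] by blast
      qed (use eps K in auto)
      also have "\<dots> < \<epsilon> * (2 * (D + 1)) + K * (\<eta> / (2 * K))"
        using N[folded i_def] K(1) by (intro add_strict_left_mono mult_strict_left_mono) auto
      also have "\<dots> = \<eta>" using K(1) D0 by (simp add: \<epsilon>_def field_simps)
      finally show ?thesis .
    qed
    then show ?thesis by blast
  qed
  have "\<exists>N. \<forall>m\<ge>N. \<forall>n\<ge>N. Hp_norm E w \<sigma> \<rho> p (\<lambda>x. V m x - V n x) < \<epsilon>" if eps: "\<epsilon> > 0" for \<epsilon>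
  proof -
    have small: "Hp_norm E w \<sigma> \<rho> p f < \<epsilon>" if "energy f < \<epsilon> powr p" for f
    proof -
      have "energy f powr (1 / p) < (\<epsilon> powr p) powr (1 / p)"
        using that energy_nonneg p by (intro powr_less_mono2) auto
      then show ?thesis using p eps by (simp add: Hp_norm_eq powr_powr)
    qed
    have "\<epsilon> powr p > 0" using eps by simp
    then obtain N where "\<And>m n. N \<le> m \<Longrightarrow> N \<le> n \<Longrightarrow> energy (\<lambda>x. V m x - V n x) < \<epsilon> powr p"
      using cauchy by blast
    then show ?thesis using small by blast
  qed
  moreover have "(\<lambda>n. V n x) \<longlonglongrightarrow> u x" for x
  proof -
    obtain N0 where "x \<in> A N0" using A(3) by blast
    then have "x \<in> A n" if "N0 \<le> n" for n using A(2) that by (auto simp: incseq_def)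
    then have "\<forall>\<^sub>F n in sequentially. norm (V n x - u x) \<le> inverse (real (Suc n))"
      using V(1) by (intro eventually_sequentiallyI[of N0]) (auto simp: C_def)
    then have "(\<lambda>n. V n x - u x) \<longlonglongrightarrow> 0"
      by (rule Lim_null_comparison) (rule LIMSEQ_inverse_real_of_nat)
    then show ?thesis by (simp add: LIM_zero_iff)
  qed
  ultimately show ?thesis
    using V(1) unfolding Hp_space_def by (auto simp: C_def intro!: exI[of _ V])
qed

section \<open>Minimum principles\<close>

lemma p_laplacian_at_minimum:
  assumes u: "\<And>y. 0 \<le> u y" and x: "u x = 0"
  shows "0 \<le> p_laplacian E w \<sigma> p u x"
  using u x sigma_pos weight_pos unfolding p_laplacian_def
  by (intro mult_nonneg_nonneg sum_nonneg) (auto intro: less_imp_le)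

text \<open>
  At a zero minimum every term of the \<open>p\<close>-Laplacian is nonnegative, so all vanish. A neighbour with
  \<open>u y \<noteq> 0\<close> would make the gradient at \<open>x\<close> nonzero and its term positive.
\<close>

lemma strong_minimum_principle:
  assumes u: "\<And>y. 0 \<le> u y" and x: "u x = 0" "p_laplacian E w \<sigma> p u x = 0" and y: "(x, y) \<in> E"
  shows "u y = 0"
proof (rule ccontr)
  assume uy: "u y \<noteq> 0"
  let ?t = "\<lambda>y. (G u x powr (p - 2) + G u y powr (p - 2)) / 2 * w x y * (u y - u x)"
  have nn: "0 \<le> ?t z" if "z \<in> E `` {x}" for z
    using u[of z] x weight_pos[of x z] that by (intro mult_nonneg_nonneg) (auto intro: less_imp_le)
  have "(\<Sum>z\<in>E `` {x}. ?t z) = 0"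
    using x(2) sigma_pos[of x] by (simp add: p_laplacian_def)
  then have "?t y = 0"
    using sum_nonneg_eq_0_iff[of "E `` {x}" ?t] nn locally_finite[of x] y by blast
  moreover obtain K where "K > 0" "\<And>u. \<bar>u y - u x\<bar> \<le> K * G u x" using G_edge[OF y] by blast
  then have "G u x \<noteq> 0" using x uy by (metis abs_le_zero_iff diff_zero mult_zero_right)
  then have "G u x powr (p - 2) > 0" using G_nonneg[of u x] by simp
  then have "G u x powr (p - 2) + G u y powr (p - 2) > 0"
    by (meson add_pos_nonneg powr_ge_zero)
  ultimately show False using weight_pos[OF y] uy x by auto
qed

end

section \<open>The superlinear nonlinearity\<close>

text \<open>
  The number \<open>lam\<close> stands for the first eigenvalue, which enters through its variational inequality
  for finitely supported functions, \<open>spectral\<close>. The assumption \<open>AR_on\<close> is the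
  Ambrosetti--Rabinowitz condition.
\<close>

locale superlinear_problem = weighted_graph E w \<sigma> \<rho> p
  for E :: "('v \<times> 'v) set" and w :: "'v \<Rightarrow> 'v \<Rightarrow> real" and \<sigma> \<rho> :: "'v \<Rightarrow> real" and p :: real +
  fixes \<psi> :: "'v \<Rightarrow> real \<Rightarrow> real" and \<alpha> \<sigma>\<^sub>0 lam \<tau> \<delta> :: real
  assumes sigma0: "\<sigma>\<^sub>0 > 0" "\<sigma>\<^sub>0 \<le> \<sigma> x"
    and psi_zero: "\<psi> x 0 = 0"
    and psi_cont: "continuous_on {0..} (\<psi> x)"
    and alpha: "\<alpha> > p"
    and Psi_pos_on: "s > 0 \<Longrightarrow> 0 < \<alpha> * integral {0..s} (\<psi> x)"
    and AR_on: "s > 0 \<Longrightarrow> \<alpha> * integral {0..s} (\<psi> x) \<le> s * \<psi> x s"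
    and tau: "\<tau> < lam" and delta: "\<delta> > 0"
    and near_zero: "0 < s \<Longrightarrow> s < \<delta> \<Longrightarrow> \<psi> x s \<le> \<tau> * s powr (p - 1)"
    and spectral: "finite S \<Longrightarrow> (\<And>x. x \<notin> S \<Longrightarrow> u x = 0) \<Longrightarrow>
      lam * (\<Sum>x\<in>S. \<sigma> x * \<bar>u x\<bar> powr p) \<le> energy u"
begin

definition \<Psi> :: "'v \<Rightarrow> real \<Rightarrow> real" where
  "\<Psi> x s = integral {0..s} (\<psi> x)"

lemma alpha_pos: "\<alpha> > 0" using alpha p by simp

lemma Psi_zero: "\<Psi> x 0 = 0" by (simp add: \<Psi>_def)

lemma Psi_pos: "s > 0 \<Longrightarrow> 0 < \<Psi> x s"
  using Psi_pos_on[of s x] alpha_pos by (simp add: \<Psi>_def zero_less_mult_iff)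

lemma Psi_nonneg: "0 \<le> s \<Longrightarrow> 0 \<le> \<Psi> x s"
  using Psi_pos[of s x] Psi_zero[of x] by (cases "s = 0") auto

lemma AR: "0 \<le> s \<Longrightarrow> \<alpha> * \<Psi> x s \<le> s * \<psi> x s"
  using AR_on[of s x] Psi_zero[of x] by (cases "s = 0") (auto simp: \<Psi>_def)

lemma psi_pos: "s > 0 \<Longrightarrow> 0 < \<psi> x s"
  using AR[of s x] Psi_pos[of s x] alpha_pos by (smt (verit) mult_pos_pos zero_less_mult_pos)

lemma psi_mult_small:
  assumes "0 \<le> s" "s < \<delta>"
  shows "s * \<psi> x s \<le> \<tau> * s powr p"
proof (cases "s = 0")
  case False
  then have "s * \<psi> x s \<le> s * (\<tau> * s powr (p - 1))"
    using near_zero[of s x] assms by (intro mult_left_mono) auto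
  also have "\<dots> = \<tau> * s powr p"
    using assms False by (simp add: powr_mult_base algebra_simps)
  finally show ?thesis .
qed (use p in auto)

text \<open>
  Positivity of \<open>\<psi>\<close> forces it. So the eigenvalue is positive and bounds the values of a function by its
  energy even at vertices where \<open>\<rho>\<close> vanishes.
\<close>

lemma tau_pos: "\<tau> > 0"
proof -
  have "0 < \<psi> x (\<delta> / 2)" "\<psi> x (\<delta> / 2) \<le> \<tau> * (\<delta> / 2) powr (p - 1)" for x
    using psi_pos[of "\<delta> / 2" x] near_zero[of "\<delta> / 2" x] delta by auto
  then have "0 < \<tau> * (\<delta> / 2) powr (p - 1)" by (meson less_le_trans)
  then show ?thesis using delta by (simp add: zero_less_mult_iff)
qed

lemma lam_pos: "lam > 0" using tau tau_pos by simp

text \<open>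
  The Ambrosetti--Rabinowitz inequality bounds \<open>p * \<Psi> x s \<le> \<alpha> * \<Psi> x s\<close> by \<open>s * \<psi> x s\<close>, to which the
  bound on \<open>\<psi>\<close> near \<open>0\<close> applies directly.
\<close>

lemma Psi_small:
  assumes "0 \<le> s" "s < \<delta>"
  shows "p * \<Psi> x s \<le> \<tau> * s powr p"
proof -
  have "p * \<Psi> x s \<le> \<alpha> * \<Psi> x s"
    using alpha Psi_nonneg[OF assms(1)] by (intro mult_right_mono) auto
  then show ?thesis using AR[OF assms(1), of x] psi_mult_small[OF assms, of x] by linarith
qed

lemma Psi_deriv_within:
  assumes "0 \<le> s" "s \<le> b"
  shows "(\<Psi> x has_real_derivative \<psi> x s) (at s within {0..b})"
  unfolding \<Psi>_def using assms
  by (intro integral_has_real_derivative continuous_on_subset[OF psi_cont]) auto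

lemma Psi_deriv: "0 < s \<Longrightarrow> (\<Psi> x has_real_derivative \<psi> x s) (at s)"
  using Psi_deriv_within[of s "s + 1" x] at_within_interior[of s "{0..s + 1}"]
  by simp

lemma Psi_cont: "continuous_on {0..b} (\<Psi> x)"
  by (rule DERIV_continuous_on) (auto intro: Psi_deriv_within)

text \<open>
  The function \<open>\<Psi> x s * s powr - \<alpha>\<close> is nondecreasing, by the Ambrosetti--Rabinowitz
  inequality.
\<close>

lemma Psi_growth:
  assumes "1 \<le> s"
  shows "\<Psi> x 1 * s powr \<alpha> \<le> \<Psi> x s"
proof -
  have "\<Psi> x 1 * 1 powr - \<alpha> \<le> \<Psi> x s * s powr - \<alpha>"
  proof (rule DERIV_nonneg_imp_nondecreasing[OF assms])
    fix t :: real assume t: "1 \<le> t" "t \<le> s"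
    have "((\<lambda>t. \<Psi> x t * t powr - \<alpha>) has_real_derivative
        \<psi> x t * t powr - \<alpha> + (- \<alpha> * t powr (- \<alpha> - 1)) * \<Psi> x t) (at t)"
      using t by (intro DERIV_mult Psi_deriv has_real_derivative_powr) auto
    moreover have "0 \<le> \<psi> x t * t powr - \<alpha> + (- \<alpha> * t powr (- \<alpha> - 1)) * \<Psi> x t"
    proof -
      have "t powr - \<alpha> = t powr (- \<alpha> - 1) * t"
        using powr_add[of t "- \<alpha> - 1" 1] t by simp
      then have "\<psi> x t * t powr - \<alpha> + (- \<alpha> * t powr (- \<alpha> - 1)) * \<Psi> x t =
        t powr (- \<alpha> - 1) * (t * \<psi> x t - \<alpha> * \<Psi> x t)" by (simp add: algebra_simps)
      then show ?thesis using AR[of t x] t by simp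
    qed
    ultimately show "\<exists>y. ((\<lambda>t. \<Psi> x t * t powr - \<alpha>) has_real_derivative y) (at t) \<and> 0 \<le> y" by blast
  qed
  then show ?thesis using assms by (simp add: powr_minus field_simps)
qed

text \<open>
  At the end point \<open>0\<close> of its domain \<open>\<Psi> x\<close> has a one-sided derivative, hence the mean value theorem
  relative to the closed interval.
\<close>

lemma Psi_increment:
  assumes "0 \<le> a" "0 \<le> b"
  shows "\<exists>c. min a b \<le> c \<and> c \<le> max a b \<and> \<Psi> x b - \<Psi> x a = \<psi> x c * (b - a)"
proof -
  have *: "\<exists>c. a \<le> c \<and> c \<le> b \<and> \<Psi> x b - \<Psi> x a = \<psi> x c * (b - a)" if "0 \<le> a" "a < b" for a b
  proof -
    have "(\<Psi> x has_derivative (\<lambda>h. \<psi> x t * h)) (at t within {a..b})" if "a \<le> t" "t \<le> b" for t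
      using Psi_deriv_within[of t b x] that \<open>0 \<le> a\<close>
      by (intro has_derivative_subset[of _ _ _ "{0..b}" "{a..b}"]) (auto simp: has_field_derivative_def)
    then obtain c where "c \<in> {a<..<b}" "\<Psi> x b - \<Psi> x a = \<psi> x c * (b - a)"
      using mvt_simple[OF \<open>a < b\<close>, of "\<Psi> x" "\<lambda>t h. \<psi> x t * h"] by blast
    then show ?thesis by (intro exI[of _ c]) auto
  qed
  consider "a < b" | "b < a" | "a = b" by linarith
  then show ?thesis
  proof cases
    case 1 then show ?thesis using *[OF assms(1) 1] by (auto simp: min_def max_def)
  next
    case 2
    then obtain c where "b \<le> c" "c \<le> a" "\<Psi> x a - \<Psi> x b = \<psi> x c * (a - b)"
      using *[OF assms(2)] by blast
    then show ?thesis using 2 by (intro exI[of _ c]) (auto simp: algebra_simps)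
  next
    case 3 then show ?thesis by auto
  qed
qed

section \<open>Solutions on finite vertex sets\<close>

definition J :: "'v set \<Rightarrow> ('v \<Rightarrow> real) \<Rightarrow> real" where
  "J S u = energy u / p - (\<Sum>x\<in>S. \<sigma> x * \<Psi> x (u x))"

lemma Psi_ptw: "x \<in> S \<Longrightarrow> ptw_continuous_on (cube S R) (\<lambda>u. \<Psi> x (u x))"
  unfolding ptw_continuous_on_def
proof (intro allI impI)
  fix U :: "nat \<Rightarrow> 'v \<Rightarrow> real" and u
  assume x: "x \<in> S" and U: "\<forall>n. U n \<in> cube S R" "u \<in> cube S R" "\<forall>x. (\<lambda>n. U n x) \<longlonglongrightarrow> u x"
  then show "(\<lambda>n. \<Psi> x (U n x)) \<longlonglongrightarrow> \<Psi> x (u x)"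
    by (intro continuous_on_tendsto_compose[OF Psi_cont[of R]]) (auto simp: cube_def)
qed

lemma psi_ptw: "x \<in> S \<Longrightarrow> ptw_continuous_on (cube S R) (\<lambda>u. \<psi> x (u x))"
  unfolding ptw_continuous_on_def
proof (intro allI impI)
  fix U :: "nat \<Rightarrow> 'v \<Rightarrow> real" and u
  assume x: "x \<in> S" and U: "\<forall>n. U n \<in> cube S R" "u \<in> cube S R" "\<forall>x. (\<lambda>n. U n x) \<longlonglongrightarrow> u x"
  then show "(\<lambda>n. \<psi> x (U n x)) \<longlonglongrightarrow> \<psi> x (u x)"
    by (intro continuous_on_tendsto_compose[OF psi_cont]) (auto simp: cube_def)
qed

lemma L_ptw: "ptw_continuous_on (cube S R) (\<lambda>u. L u x)"
  unfolding ptw_continuous_on_def by (auto intro: L_tendsto)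

lemma J_ptw:
  assumes "finite S"
  shows "ptw_continuous_on (cube S R) (J S)"
  unfolding ptw_continuous_on_def J_def
proof (intro allI impI tendsto_diff tendsto_divide tendsto_const tendsto_sum tendsto_mult_left)
  fix U :: "nat \<Rightarrow> 'v \<Rightarrow> real" and u
  assume U: "\<forall>n. U n \<in> cube S R" "u \<in> cube S R" "\<forall>x. (\<lambda>n. U n x) \<longlonglongrightarrow> u x"
  show "(\<lambda>n. energy (U n)) \<longlonglongrightarrow> energy u"
    by (rule ptw_continuous_onD[OF energy_continuous[OF assms]]) (use U in auto)
  show "(\<lambda>n. \<Psi> x (U n x)) \<longlonglongrightarrow> \<Psi> x (u x)" if "x \<in> S" for x
    by (rule ptw_continuous_onD[OF Psi_ptw[OF that]]) (use U in auto)
qed (use p in auto)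

text \<open>
  The partial derivatives of \<open>J S\<close>, for every \<open>S\<close> that contains \<open>x\<close>.
\<close>

definition g :: "('v \<Rightarrow> real) \<Rightarrow> 'v \<Rightarrow> real" where
  "g u x = \<sigma> x * (L u x - \<psi> x (u x))"

lemma g_ptw: "x \<in> S \<Longrightarrow> ptw_continuous_on (cube S R) (\<lambda>u. g u x)"
  unfolding ptw_continuous_on_def g_def
  by (intro allI impI tendsto_mult_left tendsto_diff)
    (auto intro: ptw_continuous_onD[OF L_ptw] ptw_continuous_onD[OF psi_ptw])

text \<open>
  For the convex part the gradient inequality is used at the new point \<open>h\<close>, which bounds the increment
  from above; for \<open>\<Psi>\<close> the mean value theorem is used coordinatewise. Both
  produce the gradient at a point near \<open>u\<close>, and \<open>L\<close> and \<open>\<psi>\<close> are uniformly continuous on the box.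
\<close>

lemma J_smooth:
  assumes S: "finite S" and \<omega>: "\<omega> > 0"
  shows "\<exists>d>0. \<forall>u\<in>cube S R. \<forall>h\<in>cube S R. (\<forall>x\<in>S. \<bar>h x - u x\<bar> \<le> d) \<longrightarrow>
      J S h \<le> J S u + (\<Sum>x\<in>S. g u x * (h x - u x)) + \<omega> * (\<Sum>x\<in>S. \<bar>h x - u x\<bar>)"
proof -
  have L: "ptw_continuous_on (cube S R) (\<lambda>u. \<sigma> x * L u x)" for x
    unfolding ptw_continuous_on_def by (auto intro!: tendsto_mult_left L_tendsto)
  have P: "ptw_continuous_on (cube S R) (\<lambda>u. \<sigma> x * \<psi> x (u x))" if "x \<in> S" for x
    using psi_ptw[OF that, of R] unfolding ptw_continuous_on_def by (auto intro!: tendsto_mult_left)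
  have "\<omega> / 2 > 0" using \<omega> by simp
  obtain d1 where d1: "d1 > 0" "\<forall>u\<in>cube S R. \<forall>h\<in>cube S R. (\<forall>y\<in>S. \<bar>h y - u y\<bar> \<le> d1) \<longrightarrow>
      (\<forall>x\<in>S. \<bar>\<sigma> x * L h x - \<sigma> x * L u x\<bar> \<le> \<omega> / 2)"
    using cube_uniformly_continuous[of S R "\<lambda>x u. \<sigma> x * L u x", OF S L \<open>\<omega> / 2 > 0\<close>] by auto
  obtain d2 where d2: "d2 > 0" "\<forall>u\<in>cube S R. \<forall>h\<in>cube S R. (\<forall>y\<in>S. \<bar>h y - u y\<bar> \<le> d2) \<longrightarrow>
      (\<forall>x\<in>S. \<bar>\<sigma> x * \<psi> x (h x) - \<sigma> x * \<psi> x (u x)\<bar> \<le> \<omega> / 2)"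
    using cube_uniformly_continuous[of S R "\<lambda>x u. \<sigma> x * \<psi> x (u x)", OF S P \<open>\<omega> / 2 > 0\<close>] by auto
  show ?thesis
  proof (intro exI[of _ "min d1 d2"] conjI ballI impI)
    show "min d1 d2 > 0" using d1 d2 by simp
    fix u h assume u: "u \<in> cube S R" and h: "h \<in> cube S R" and close: "\<forall>x\<in>S. \<bar>h x - u x\<bar> \<le> min d1 d2"
    have "\<exists>c. min (u x) (h x) \<le> c \<and> c \<le> max (u x) (h x) \<and> \<Psi> x (h x) - \<Psi> x (u x) = \<psi> x c * (h x - u x)"
      if "x \<in> S" for x
      using Psi_increment[of "u x" "h x" x] u h that by (simp add: cube_def)
    then obtain c where c: "\<And>x. x \<in> S \<Longrightarrow> min (u x) (h x) \<le> c x \<and> c x \<le> max (u x) (h x) \<and>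
        \<Psi> x (h x) - \<Psi> x (u x) = \<psi> x (c x) * (h x - u x)"
      by metis
    \<comment> \<open>The intermediate values form a point of the box, so that uniform continuity applies to it.\<close>
    define k where "k x = (if x \<in> S then c x else 0)" for x
    have kc: "k \<in> cube S R"
      unfolding cube_def
    proof (intro CollectI conjI ballI allI impI)
      fix x assume x: "x \<in> S"
      show "0 \<le> k x" "k x \<le> R"
        using c[OF x] u h x by (auto simp: k_def cube_def min_def max_def split: if_splits intro: order_trans)
    qed (simp add: k_def)
    have kclose: "\<forall>y\<in>S. \<bar>k y - u y\<bar> \<le> d2"
    proof
      fix y assume y: "y \<in> S"
      have "\<bar>k y - u y\<bar> \<le> \<bar>h y - u y\<bar>"
        using c[OF y] y by (auto simp: k_def)
      then show "\<bar>k y - u y\<bar> \<le> d2" using close y by force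
    qed
    have e1: "\<forall>x\<in>S. \<bar>\<sigma> x * L h x - \<sigma> x * L u x\<bar> \<le> \<omega> / 2"
      using d1(2) u h close by simp
    have e2: "\<forall>x\<in>S. \<bar>\<sigma> x * \<psi> x (k x) - \<sigma> x * \<psi> x (u x)\<bar> \<le> \<omega> / 2"
      using d2(2) u kc kclose by blast
    have "energy h / p \<le> energy u / p + (\<Sum>x\<in>S. \<sigma> x * L h x * (h x - u x))"
    proof -
      have "energy h + p * (\<Sum>x\<in>S. \<sigma> x * L h x * (u x - h x)) \<le> energy u"
        using u h by (intro energy_convex S) (auto simp: cube_def)
      moreover have "(\<Sum>x\<in>S. \<sigma> x * L h x * (u x - h x)) = - (\<Sum>x\<in>S. \<sigma> x * L h x * (h x - u x))"
        unfolding sum_negf[symmetric] by (intro sum.cong) (auto simp: algebra_simps)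
      ultimately show ?thesis using p by (simp add: field_simps)
    qed
    moreover have "(\<Sum>x\<in>S. \<sigma> x * \<Psi> x (h x)) = (\<Sum>x\<in>S. \<sigma> x * \<Psi> x (u x)) +
        (\<Sum>x\<in>S. \<sigma> x * \<psi> x (k x) * (h x - u x))"
      unfolding sum.distrib[symmetric]
    proof (rule sum.cong)
      fix x assume x: "x \<in> S"
      have eq: "\<Psi> x (h x) = \<Psi> x (u x) + \<psi> x (k x) * (h x - u x)" using c[OF x] x by (simp add: k_def)
      show "\<sigma> x * \<Psi> x (h x) = \<sigma> x * \<Psi> x (u x) + \<sigma> x * \<psi> x (k x) * (h x - u x)"
        unfolding eq by (simp add: algebra_simps)
    qed simp
    ultimately have "J S h \<le> J S u + (\<Sum>x\<in>S. \<sigma> x * L h x * (h x - u x)) - (\<Sum>x\<in>S. \<sigma> x * \<psi> x (k x) * (h x - u x))"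
      by (simp add: J_def)
    also have "\<dots> = J S u + (\<Sum>x\<in>S. (\<sigma> x * L h x - \<sigma> x * \<psi> x (k x)) * (h x - u x))"
      by (simp add: sum_subtractf left_diff_distrib)
    also have "\<dots> \<le> J S u + (\<Sum>x\<in>S. g u x * (h x - u x) + \<omega> * \<bar>h x - u x\<bar>)"
    proof (intro add_left_mono sum_mono)
      fix x assume x: "x \<in> S"
      have "\<bar>\<sigma> x * L h x - \<sigma> x * \<psi> x (k x) - g u x\<bar> \<le> \<omega>"
        using bspec[OF e1 x] bspec[OF e2 x] unfolding g_def right_diff_distrib by linarith
      then have "\<bar>\<sigma> x * L h x - \<sigma> x * \<psi> x (k x) - g u x\<bar> * \<bar>h x - u x\<bar> \<le> \<omega> * \<bar>h x - u x\<bar>"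
        by (rule mult_right_mono) simp
      moreover have "z * y \<le> \<bar>z\<bar> * \<bar>y\<bar>" for z y :: real
        by (simp flip: abs_mult)
      ultimately have "(\<sigma> x * L h x - \<sigma> x * \<psi> x (k x) - g u x) * (h x - u x) \<le> \<omega> * \<bar>h x - u x\<bar>"
        by (rule order_trans[rotated])
      then show "(\<sigma> x * L h x - \<sigma> x * \<psi> x (k x)) * (h x - u x) \<le> g u x * (h x - u x) + \<omega> * \<bar>h x - u x\<bar>"
        unfolding left_diff_distrib by linarith
    qed
    finally show "J S h \<le> J S u + (\<Sum>x\<in>S. g u x * (h x - u x)) + \<omega> * (\<Sum>x\<in>S. \<bar>h x - u x\<bar>)"
      by (simp add: sum.distrib sum_distrib_left)
  qed
qed

text \<open>
  By homogeneity the energy on the box of side \<open>R\<close> is at most a multiple of \<open>R powr p\<close>, while a single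
  value \<open>R\<close> contributes a multiple of \<open>R powr \<alpha>\<close> to the other term.
\<close>

lemma J_negative_far:
  assumes S: "finite S" "S \<noteq> {}"
  shows "\<exists>R0\<ge>1. \<forall>R\<ge>R0. \<forall>u\<in>cube S R. \<forall>x\<in>S. u x = R \<longrightarrow> J S u < 0"
proof -
  obtain K where K: "K > 0" "\<And>v. v \<in> cube S 1 \<Longrightarrow> \<bar>energy v\<bar> \<le> K"
    using cube_bounded[OF S(1) energy_continuous[OF S(1), of 1]] by blast
  define c where "c = Min ((\<lambda>x. \<sigma> x * \<Psi> x 1) ` S)"
  have c: "c > 0" "\<And>x. x \<in> S \<Longrightarrow> c \<le> \<sigma> x * \<Psi> x 1"
    using S sigma_pos Psi_pos[of 1] by (auto simp: c_def Min_gr_iff)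
  define R0 where "R0 = max 1 ((K / (p * c) + 1) powr (1 / (\<alpha> - p)))"
  have "J S u < 0" if R: "R \<ge> R0" and u: "u \<in> cube S R" and x: "x \<in> S" "u x = R" for R u x
  proof -
    have R1: "R \<ge> 1" using R by (simp add: R0_def)
    have Kpc: "K / (p * c) > 0" using K c p by simp
    define v where "v x = u x / R" for x
    have "v \<in> cube S 1" using u R1 by (auto simp: cube_def v_def field_simps)
    then have "energy v \<le> K" using K(2)[of v] by simp
    moreover have "energy (\<lambda>x. R * v x) = \<bar>R\<bar> powr p * energy v"
      using u by (intro energy_scale[OF S(1)]) (auto simp: cube_def v_def)
    moreover have "(\<lambda>x. R * v x) = u" using R1 by (auto simp: v_def)
    ultimately have eu: "energy u \<le> R powr p * K" using R1 by (simp add: mult_left_mono)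
    have "((K / (p * c) + 1) powr (1 / (\<alpha> - p))) powr (\<alpha> - p) \<le> R powr (\<alpha> - p)"
      using R alpha by (intro powr_mono2) (auto simp: R0_def)
    moreover have "((K / (p * c) + 1) powr (1 / (\<alpha> - p))) powr (\<alpha> - p) = K / (p * c) + 1"
      using alpha Kpc by (simp add: powr_powr)
    ultimately have "K / (p * c) < R powr (\<alpha> - p)" by simp
    then have "R powr p * (K / (p * c)) < R powr p * R powr (\<alpha> - p)"
      using R1 by (intro mult_strict_left_mono) auto
    also have "\<dots> = R powr \<alpha>" by (simp flip: powr_add)
    finally have "R powr p * K / p < c * R powr \<alpha>"
      using c p by (simp add: field_simps)
    also have "c * R powr \<alpha> \<le> \<sigma> x * \<Psi> x 1 * R powr \<alpha>"
      using c(2)[OF x(1)] by (intro mult_right_mono) auto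
    also have "\<dots> \<le> \<sigma> x * \<Psi> x R"
      using Psi_growth[OF R1, of x] sigma_pos[of x] by (simp add: mult.assoc)
    also have "\<dots> \<le> (\<Sum>x\<in>S. \<sigma> x * \<Psi> x (u x))"
    proof -
      have "\<sigma> x * \<Psi> x (u x) \<le> (\<Sum>x\<in>S. \<sigma> x * \<Psi> x (u x))"
        using x S u by (intro member_le_sum mult_nonneg_nonneg less_imp_le[OF sigma_pos] Psi_nonneg) (auto simp: cube_def)
      then show ?thesis using x by simp
    qed
    finally have "R powr p * K / p < (\<Sum>x\<in>S. \<sigma> x * \<Psi> x (u x))" .
    moreover have "energy u / p \<le> R powr p * K / p" using eu p by (intro divide_right_mono) auto
    ultimately show ?thesis by (simp add: J_def)
  qed
  moreover have "R0 \<ge> 1" by (simp add: R0_def)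
  ultimately show ?thesis by blast
qed

text \<open>
  This separates the valley of \<open>J S\<close> at \<open>0\<close> from the rest of the box: the energy is at least \<open>lam\<close> times
  the weighted \<open>p\<close>-sum of the values, the second term of \<open>J S\<close> at most \<open>\<tau> / p\<close> times it.
\<close>

lemma J_lower_near_zero:
  assumes S: "finite S" and u: "\<And>x. x \<notin> S \<Longrightarrow> u x = 0" "\<And>x. 0 \<le> u x" "\<And>x. x \<in> S \<Longrightarrow> u x < \<delta>"
    and x: "x \<in> S"
  shows "(lam - \<tau>) / p * (\<sigma>\<^sub>0 * u x powr p) \<le> J S u"
proof -
  let ?N = "\<Sum>x\<in>S. \<sigma> x * \<bar>u x\<bar> powr p"
  have "p * (\<Sum>x\<in>S. \<sigma> x * \<Psi> x (u x)) = (\<Sum>x\<in>S. \<sigma> x * (p * \<Psi> x (u x)))"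
    by (simp add: sum_distrib_left algebra_simps)
  also have "\<dots> \<le> (\<Sum>x\<in>S. \<sigma> x * (\<tau> * \<bar>u x\<bar> powr p))"
    using u Psi_small by (intro sum_mono mult_left_mono less_imp_le[OF sigma_pos]) auto
  also have "\<dots> = \<tau> * ?N" by (simp add: sum_distrib_left algebra_simps)
  finally have "(lam - \<tau>) * ?N \<le> p * J S u"
    using spectral[OF S, of u] u(1) p by (simp add: J_def algebra_simps)
  moreover have "\<sigma>\<^sub>0 * u x powr p \<le> ?N"
  proof -
    have "\<sigma>\<^sub>0 * u x powr p \<le> \<sigma> x * \<bar>u x\<bar> powr p"
      using sigma0 u(2) less_imp_le[OF sigma_pos] by (intro mult_mono) auto
    also have "\<dots> \<le> ?N"
      using S x by (intro member_le_sum mult_nonneg_nonneg less_imp_le[OF sigma_pos]) auto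
    finally show ?thesis .
  qed
  then have "(lam - \<tau>) * (\<sigma>\<^sub>0 * u x powr p) \<le> (lam - \<tau>) * ?N"
    using tau by (intro mult_left_mono) auto
  ultimately have "(lam - \<tau>) * (\<sigma>\<^sub>0 * u x powr p) \<le> p * J S u" by linarith
  then show ?thesis using p by (simp add: field_simps)
qed

text \<open>
  The far end of the segment is supported at the single vertex \<open>v\<^sub>0\<close> and chosen before \<open>S\<close>; only the
  side of the box depends on \<open>S\<close>. This makes the bound \<open>C\<close> uniform.
\<close>

lemma solution_on_finite_set:
  obtains C where "\<And>S. finite S \<Longrightarrow> v\<^sub>0 \<in> S \<Longrightarrow> \<exists>u. (\<forall>x. x \<notin> S \<longrightarrow> u x = 0) \<and> (\<forall>x. 0 \<le> u x) \<and>
    u \<noteq> (\<lambda>_. 0) \<and> J S u \<le> C \<and> (\<forall>x\<in>S. L u x = \<psi> x (u x))"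
proof -
  obtain R1 where R1: "R1 \<ge> 1" "\<And>u. u \<in> cube {v\<^sub>0} R1 \<Longrightarrow> u v\<^sub>0 = R1 \<Longrightarrow> J {v\<^sub>0} u < 0"
    using J_negative_far[of "{v\<^sub>0}"] by auto
  define e where "e x = (if x = v\<^sub>0 then R1 else 0)" for x
  show ?thesis
  proof (rule that[of "energy e / p"])
    fix S assume S: "finite S" "v\<^sub>0 \<in> S"
    obtain R2 where R2: "R2 \<ge> 1" "\<And>R u x. R \<ge> R2 \<Longrightarrow> u \<in> cube S R \<Longrightarrow> x \<in> S \<Longrightarrow> u x = R \<Longrightarrow> J S u < 0"
      using J_negative_far[of S] S by blast
    define R where "R = max R1 R2"
    have R: "R > 0" "R \<ge> R1" "R \<ge> R2" using R1 R2 by (auto simp: R_def)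
    have eQ: "e \<in> cube S R" using S R R1 by (auto simp: e_def cube_def)
    have "(\<Sum>x\<in>S. \<sigma> x * \<Psi> x (e x)) = (\<Sum>x\<in>{v\<^sub>0}. \<sigma> x * \<Psi> x (e x))"
      using S by (intro sum.mono_neutral_right) (auto simp: e_def Psi_zero)
    then have "J S e = J {v\<^sub>0} e" by (simp add: J_def)
    also have "\<dots> < 0" using R1 by (intro R1(2)) (auto simp: e_def cube_def)
    finally have eneg: "J S e < 0" .
    have ray: "J S (\<lambda>x. s * e x) \<le> energy e / p" if "0 \<le> s" "s \<le> 1" for s
    proof -
      have "energy (\<lambda>x. s * e x) = \<bar>s\<bar> powr p * energy e"
        using S by (intro energy_scale[OF S(1)]) (auto simp: e_def)
      also have "\<dots> \<le> 1 * energy e"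
        using that p energy_nonneg[of e] by (intro mult_right_mono) (auto intro: powr_le1)
      finally have "energy (\<lambda>x. s * e x) / p \<le> energy e / p" using p by (simp add: divide_right_mono)
      moreover have "0 \<le> (\<Sum>x\<in>S. \<sigma> x * \<Psi> x (s * e x))"
        using that R1 by (intro sum_nonneg mult_nonneg_nonneg less_imp_le[OF sigma_pos] Psi_nonneg) (auto simp: e_def)
      ultimately show ?thesis by (simp add: J_def)
    qed
    define b where "b = (lam - \<tau>) / p * (\<sigma>\<^sub>0 * (\<delta> / 2) powr p)"
    have b: "b > 0" using tau p sigma0(1) delta by (simp add: b_def)
    have zero: "J S (\<lambda>_. 0) < b"
      using b by (simp add: J_def Psi_zero energy_def vint_def grad_norm_def)
    have valley: "0 \<le> J S u \<and> (\<forall>x\<in>S. u x < \<delta> / 2)"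
      if u: "u \<in> cube S R" "\<And>x. x \<in> S \<Longrightarrow> u x < \<delta>" "J S u < b" for u
    proof
      have u0: "\<And>x. x \<notin> S \<Longrightarrow> u x = 0" "\<And>x. 0 \<le> u x"
        using u(1) by (auto simp: cube_def)
      have low: "(lam - \<tau>) / p * (\<sigma>\<^sub>0 * u x powr p) \<le> J S u" if "x \<in> S" for x
        using S(1) u0 u(2) that by (rule J_lower_near_zero)
      have "0 \<le> (lam - \<tau>) / p * (\<sigma>\<^sub>0 * u v\<^sub>0 powr p)" using tau p sigma0(1) by simp
      then show "0 \<le> J S u" using low[OF S(2)] by linarith
      show "\<forall>x\<in>S. u x < \<delta> / 2"
      proof (rule ccontr)
        assume "\<not> ?thesis"
        then obtain x where x: "x \<in> S" "\<delta> / 2 \<le> u x" by (auto simp: not_less)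
        have "b \<le> (lam - \<tau>) / p * (\<sigma>\<^sub>0 * u x powr p)"
          unfolding b_def using tau p sigma0(1) x delta by (intro mult_left_mono powr_mono2) auto
        then show False using low[OF x(1)] u(3) by linarith
      qed
    qed
    obtain u where u: "u \<in> cube S R" "u \<noteq> (\<lambda>_. 0)" "0 \<le> J S u" "J S u \<le> energy e / p"
        "\<And>x. x \<in> S \<Longrightarrow> clip R (u x - g u x) = u x"
      using cube_mountain_pass[of S R "J S" g b \<delta> e "energy e / p",
        OF S(1) R(1) J_ptw[OF S(1)] g_ptw J_smooth[OF S(1)] zero delta valley eQ eneg ray] by blast
    have u0: "\<And>x. x \<notin> S \<Longrightarrow> u x = 0" "\<And>x. 0 \<le> u x"
      using u(1) by (auto simp: cube_def)
    have "L u x = \<psi> x (u x)" if x: "x \<in> S" for x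
    proof -
      have "u x < R"
        using R2(2)[OF R(3) u(1) x] u(1,3) x by (force simp: cube_def)
      show ?thesis
      proof (cases "u x = 0")
        case True
        then have "0 \<le> g u x" using u(5)[OF x] R by (auto simp: clip_def max_def min_def split: if_splits)
        then have "0 \<le> L u x"
          using True sigma_pos[of x] by (simp add: g_def psi_zero zero_le_mult_iff)
        moreover have "L u x \<le> 0"
          using p_laplacian_at_minimum[of u x] u0 True by (simp add: L_def)
        ultimately show ?thesis using True by (simp add: psi_zero)
      next
        case False
        then have "g u x = 0"
          using u(5)[OF x] u0(2)[of x] \<open>u x < R\<close> by (auto simp: clip_def max_def min_def split: if_splits)
        then show ?thesis using sigma_pos[of x] by (simp add: g_def)
      qed
    qed
    then show "\<exists>u. (\<forall>x. x \<notin> S \<longrightarrow> u x = 0) \<and> (\<forall>x. 0 \<le> u x) \<and> u \<noteq> (\<lambda>_. 0) \<and>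
        J S u \<le> energy e / p \<and> (\<forall>x\<in>S. L u x = \<psi> x (u x))"
      using u u0 by blast
  qed
qed

text \<open>
  Testing the equation with \<open>u\<close> itself gives \<open>energy u\<close> as the sum of \<open>\<sigma> x * (u x * \<psi> x (u x))\<close>, which
  is at least \<open>\<alpha>\<close> times the second term of \<open>J S u\<close>; and \<open>\<alpha> / p > 1\<close>.
\<close>

lemma energy_le_of_solution:
  assumes S: "finite S" and u: "\<And>x. x \<notin> S \<Longrightarrow> u x = 0" "\<And>x. 0 \<le> u x"
    and sol: "\<And>x. x \<in> S \<Longrightarrow> L u x = \<psi> x (u x)" and C: "J S u \<le> C"
  shows "energy u \<le> \<alpha> * C * p / (\<alpha> - p)"
proof -
  have "\<alpha> * (\<Sum>x\<in>S. \<sigma> x * \<Psi> x (u x)) = (\<Sum>x\<in>S. \<sigma> x * (\<alpha> * \<Psi> x (u x)))"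
    by (simp add: sum_distrib_left algebra_simps)
  also have "\<dots> \<le> (\<Sum>x\<in>S. \<sigma> x * (u x * \<psi> x (u x)))"
    using u by (intro sum_mono mult_left_mono less_imp_le[OF sigma_pos] AR) auto
  also have "\<dots> = (\<Sum>x\<in>S. \<sigma> x * L u x * u x)"
    using sol by (intro sum.cong) auto
  also have "\<dots> = energy u"
    using S u(1) by (rule energy_eq_pairing[symmetric])
  finally have "\<alpha> * (energy u / p) - energy u \<le> \<alpha> * J S u"
    unfolding J_def by (simp add: algebra_simps)
  also have "\<dots> \<le> \<alpha> * C" using C alpha_pos by simp
  finally have "(\<alpha> - p) * energy u \<le> \<alpha> * C * p" using p by (simp add: field_simps)
  then show ?thesis using alpha by (simp add: field_simps)
qed

text \<open>
  A solution below \<open>\<delta>\<close> would satisfy \<open>lam * N \<le> energy u \<le> \<tau> * N\<close> for its weighted \<open>p\<close>-sum \<open>N\<close>, although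
  \<open>\<tau> < lam\<close>.
\<close>

lemma solution_not_small:
  assumes S: "finite S" and u: "\<And>x. x \<notin> S \<Longrightarrow> u x = 0" "\<And>x. 0 \<le> u x" "u \<noteq> (\<lambda>_. 0)"
    and sol: "\<And>x. x \<in> S \<Longrightarrow> L u x = \<psi> x (u x)"
  shows "\<exists>x. \<delta> \<le> u x"
proof (rule ccontr)
  assume "\<not> ?thesis"
  then have small: "u x < \<delta>" for x by (simp add: not_le)
  let ?N = "\<Sum>x\<in>S. \<sigma> x * \<bar>u x\<bar> powr p"
  have "energy u = (\<Sum>x\<in>S. \<sigma> x * L u x * u x)"
    using S u(1) by (rule energy_eq_pairing)
  also have "\<dots> = (\<Sum>x\<in>S. \<sigma> x * (u x * \<psi> x (u x)))"
    using sol by (intro sum.cong) auto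
  also have "\<dots> \<le> (\<Sum>x\<in>S. \<sigma> x * (\<tau> * \<bar>u x\<bar> powr p))"
    using psi_mult_small[OF u(2) small] u(2) by (intro sum_mono mult_left_mono less_imp_le[OF sigma_pos]) auto
  also have "\<dots> = \<tau> * ?N" by (simp add: sum_distrib_left algebra_simps)
  finally have "lam * ?N \<le> \<tau> * ?N" using spectral[OF S, of u] u(1) by simp
  then have "?N \<le> 0" using tau by (simp add: mult_le_cancel_right)
  obtain x where x: "u x \<noteq> 0" using u(3) by auto
  then have xS: "x \<in> S" using u(1) by blast
  have "0 < \<sigma> x * \<bar>u x\<bar> powr p" using x sigma_pos by simp
  also have "\<dots> \<le> ?N"
    using S xS by (intro member_le_sum mult_nonneg_nonneg less_imp_le[OF sigma_pos]) auto
  finally show False using \<open>?N \<le> 0\<close> by simp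
qed

section \<open>Passage to the whole graph\<close>

text \<open>
  The vertex \<open>v\<^sub>0\<close> anchors the uniform bound on the critical levels; it has to lie in every set of the
  exhaustion, which is why the sequence \<open>A\<close> is shifted.
\<close>

theorem positive_solution:
  fixes A :: "nat \<Rightarrow> 'v set"
  assumes A: "\<And>n. finite (A n)" "incseq A" "(\<Union>n. A n) = UNIV"
    and coercive: "\<And>Z. finite {x. \<rho> x < Z}"
    and connected: "\<And>x y. (x, y) \<in> E\<^sup>*"
  shows "\<exists>u\<in>Hp_space E w \<sigma> \<rho> p. (\<forall>x. L u x = \<psi> x (u x)) \<and> (\<forall>x. u x > 0)"
proof -
  fix v\<^sub>0 :: 'v
  obtain n0 where n0: "v\<^sub>0 \<in> A n0" using A(3) by blast
  define S where "S n = A (n + n0)" for n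
  have S: "finite (S n)" "v\<^sub>0 \<in> S n" for n
    using A(1,2) n0 by (auto simp: S_def incseq_def) (metis le_add2 subsetD)
  have ev_S: "\<forall>\<^sub>F n in sequentially. x \<in> S n" for x
  proof -
    obtain m where "x \<in> A m" using A(3) by blast
    then show ?thesis
      using A(2) by (intro eventually_sequentiallyI[of m]) (auto simp: S_def incseq_def dest: trans_le_add1)
  qed
  obtain C where C: "\<And>S. finite S \<Longrightarrow> v\<^sub>0 \<in> S \<Longrightarrow> \<exists>u. (\<forall>x. x \<notin> S \<longrightarrow> u x = 0) \<and> (\<forall>x. 0 \<le> u x) \<and>
    u \<noteq> (\<lambda>_. 0) \<and> J S u \<le> C \<and> (\<forall>x\<in>S. L u x = \<psi> x (u x))"
    using solution_on_finite_set[of v\<^sub>0] by blast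
  then have "\<exists>u. (\<forall>x. x \<notin> S n \<longrightarrow> u x = 0) \<and> (\<forall>x. 0 \<le> u x) \<and>
    u \<noteq> (\<lambda>_. 0) \<and> J (S n) u \<le> C \<and> (\<forall>x\<in>S n. L u x = \<psi> x (u x))" for n
    using S by blast
  then obtain U where U: "\<And>n x. x \<notin> S n \<Longrightarrow> U n x = 0" "\<And>n x. 0 \<le> U n x" "\<And>n. U n \<noteq> (\<lambda>_. 0)"
    "\<And>n. J (S n) (U n) \<le> C" "\<And>n x. x \<in> S n \<Longrightarrow> L (U n) x = \<psi> x (U n x)"
    by metis
  define B where "B = \<alpha> * C * p / (\<alpha> - p)"
  have B: "energy (U n) \<le> B" for n
    unfolding B_def by (rule energy_le_of_solution[OF S(1) U(1,2,5,4)])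
  have B0: "0 \<le> B" using B[of 0] energy_nonneg[of "U 0"] by linarith
  have fin: "U n \<in> fin_supp" for n
  proof -
    have "{x. U n x \<noteq> 0} \<subseteq> S n" using U(1) by auto
    then show ?thesis using S(1) by (auto simp: fin_supp_def intro: finite_subset)
  qed
  have bnd: "U n x \<le> (B / (lam * \<sigma>\<^sub>0)) powr (1 / p)" for n x
  proof (cases "x \<in> S n")
    case True
    have "\<sigma>\<^sub>0 * U n x powr p \<le> \<sigma> x * \<bar>U n x\<bar> powr p"
      using sigma0 U(2) less_imp_le[OF sigma_pos] by (intro mult_mono) auto
    also have "\<dots> \<le> (\<Sum>x\<in>S n. \<sigma> x * \<bar>U n x\<bar> powr p)"
      using S True by (intro member_le_sum mult_nonneg_nonneg less_imp_le[OF sigma_pos]) auto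
    finally have "lam * (\<sigma>\<^sub>0 * U n x powr p) \<le> lam * (\<Sum>x\<in>S n. \<sigma> x * \<bar>U n x\<bar> powr p)"
      using lam_pos by (intro mult_left_mono) auto
    also have "\<dots> \<le> B" using spectral[OF S(1), of n "U n"] U(1) B[of n] by force
    finally have "U n x powr p \<le> B / (lam * \<sigma>\<^sub>0)" using lam_pos sigma0(1) by (simp add: field_simps)
    then have "(U n x powr p) powr (1 / p) \<le> (B / (lam * \<sigma>\<^sub>0)) powr (1 / p)"
      using p by (intro powr_mono2) auto
    then show ?thesis using p U(2)[of n x] by (simp add: powr_powr)
  qed (use U(1) in auto)
  have "countable (\<Union>n. A n)"
    by (rule countable_UN) (auto intro: countable_finite A(1))
  then have cnt: "countable (UNIV :: 'v set)" using A(3) by simp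
  have nrm: "norm (U n x) \<le> (B / (lam * \<sigma>\<^sub>0)) powr (1 / p)" for n x
    using bnd[of n x] U(2)[of n x] by simp
  have "\<exists>k :: nat \<Rightarrow> nat. strict_mono k \<and> (\<forall>x. \<exists>l. (\<lambda>n. U (k n) x) \<longlonglongrightarrow> l)"
    by (rule function_convergent_subsequence[of UNIV U, OF cnt nrm]) (rule exI, rule conjI, assumption, simp)
  then obtain k where k: "strict_mono (k :: nat \<Rightarrow> nat)" "\<forall>x. \<exists>l. (\<lambda>n. U (k n) x) \<longlonglongrightarrow> l"
    by blast
  then obtain u where u: "\<And>x. (\<lambda>n. U (k n) x) \<longlonglongrightarrow> u x" by metis
  have sub: "filterlim k sequentially sequentially" using k(1) by (rule filterlim_subseq)
  have u0: "0 \<le> u x" for x by (rule LIMSEQ_le_const[OF u]) (use U(2) in auto)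
  have sol: "L u x = \<psi> x (u x)" for x
  proof (rule LIMSEQ_unique)
    show "(\<lambda>n. L (U (k n)) x) \<longlonglongrightarrow> L u x" by (rule L_tendsto) (rule u)
    have "(\<lambda>n. \<psi> x (U (k n) x)) \<longlonglongrightarrow> \<psi> x (u x)"
      by (rule continuous_on_tendsto_compose[OF psi_cont u]) (use u0 U(2) in auto)
    moreover have "\<forall>\<^sub>F n in sequentially. \<psi> x (U (k n) x) = L (U (k n)) x"
      using filterlim_iff[THEN iffD1, OF sub, rule_format, OF ev_S[of x]]
      by eventually_elim (simp add: U(5))
    ultimately show "(\<lambda>n. L (U (k n)) x) \<longlonglongrightarrow> \<psi> x (u x)"
      by (rule Lim_transform_eventually)
  qed
  have nz: "\<exists>x. u x \<noteq> 0"
  proof (rule ccontr)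
    assume "\<not> ?thesis"
    then have uz: "u x = 0" for x by simp
    \<comment> \<open>Where \<open>\<rho> x \<ge> Z\<close>, a value of at least \<open>\<delta>\<close> would by itself cost the energy \<open>B + 1\<close>.\<close>
    define Z where "Z = (B + 1) / (\<sigma>\<^sub>0 * \<delta> powr p)"
    have Z: "Z > 0" using B0 sigma0(1) delta by (simp add: Z_def)
    have far: "U n x < \<delta>" if "Z \<le> \<rho> x" for n x
    proof (rule ccontr)
      assume "\<not> U n x < \<delta>"
      then have ge: "\<delta> \<le> U n x" by simp
      then have xS: "x \<in> S n" using U(1)[of x n] delta by force
      have "B + 1 = \<sigma>\<^sub>0 * (Z * \<delta> powr p)" using sigma0(1) delta by (simp add: Z_def)
      also have "\<dots> \<le> \<sigma> x * (\<rho> x * \<bar>U n x\<bar> powr p)"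
        using sigma0 that Z ge delta p by (intro mult_mono powr_mono2) (auto simp: less_imp_le[OF sigma_pos])
      also have "\<dots> \<le> \<sigma> x * (G (U n) x powr p + \<rho> x * \<bar>U n x\<bar> powr p)"
        using less_imp_le[OF sigma_pos] by (intro mult_left_mono) auto
      also have "\<dots> \<le> (\<Sum>x\<in>nbhd (S n). \<sigma> x * (G (U n) x powr p + \<rho> x * \<bar>U n x\<bar> powr p))"
        using xS finite_nbhd[OF S(1)[of n]]
        by (intro member_le_sum mult_nonneg_nonneg less_imp_le[OF sigma_pos] add_nonneg_nonneg)
          (auto simp: nbhd_def rho_nonneg)
      also have "\<dots> = energy (U n)" by (rule energy_eq_sum[OF S(1) U(1), symmetric])
      finally show False using B[of n] by simp
    qed
    have "\<forall>\<^sub>F n in sequentially. U (k n) x < \<delta>" for x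
      using u[of x] uz[of x] delta by (intro order_tendstoD(2)[of _ 0]) auto
    then have "\<forall>\<^sub>F n in sequentially. \<forall>x\<in>{x. \<rho> x < Z}. U (k n) x < \<delta>"
      using coercive by (intro eventually_ball_finite) auto
    then obtain n where "\<forall>x\<in>{x. \<rho> x < Z}. U (k n) x < \<delta>"
      using eventually_happens'[OF sequentially_bot] by blast
    then have "U (k n) x < \<delta>" for x using far[of x "k n"] by (cases "\<rho> x < Z") auto
    then show False
      using solution_not_small[OF S(1) U(1,2,3,5), of "k n"] by (meson not_le)
  qed
  have pos: "u x > 0" for x
  proof (rule ccontr)
    assume "\<not> u x > 0"
    then have ux: "u x = 0" using u0[of x] by simp
    have "u y = 0" for y
      using connected[of x y]
    proof (induction rule: rtrancl_induct)
      case base show ?case by (rule ux)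
    next
      case (step y z)
      have "p_laplacian E w \<sigma> p u y = 0"
        using sol[of y] step.IH by (simp add: L_def psi_zero)
      then show ?case by (rule strong_minimum_principle[of u y z, OF u0 step.IH _ step.hyps(2)])
    qed
    then show False using nz by blast
  qed
  have "u \<in> Hp_space E w \<sigma> \<rho> p"
    by (rule bounded_energy_limit_in_Hp[OF A, of "\<lambda>n. U (k n)" B]) (use fin B u in auto)
  then show ?thesis using sol pos by blast
qed

end

lemma finite_graph_ball:
  assumes sym_E: "sym E" and lf: "\<And>x. finite (E `` {x})" and conn: "\<And>x y. (x, y) \<in> E\<^sup>*"
  shows "finite {x. graph_dist E x v \<le> n}"
proof -
  have fin: "finite {x. (x, v) \<in> E ^^ k}" for k
  proof (induction k)
    case (Suc k)
    have "{x. (x, v) \<in> E ^^ Suc k} \<subseteq> (\<Union>y\<in>{y. (y, v) \<in> E ^^ k}. E `` {y})"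
    proof
      fix x assume "x \<in> {x. (x, v) \<in> E ^^ Suc k}"
      then obtain y where "(x, y) \<in> E" "(y, v) \<in> E ^^ k" by (auto elim: relpow_Suc_E2 simp del: relpow.simps)
      then show "x \<in> (\<Union>y\<in>{y. (y, v) \<in> E ^^ k}. E `` {y})" using sym_E by (auto dest: symD)
    qed
    then show ?case by (rule finite_subset) (use Suc lf in auto)
  qed simp
  have "{x. graph_dist E x v \<le> n} \<subseteq> (\<Union>k\<le>n. {x. (x, v) \<in> E ^^ k})"
  proof
    fix x assume x: "x \<in> {x. graph_dist E x v \<le> n}"
    obtain k where "(x, v) \<in> E ^^ k" using conn[of x v] by (auto simp: rtrancl_power)
    then have "(x, v) \<in> E ^^ graph_dist E x v" unfolding graph_dist_def by (rule LeastI)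
    then show "x \<in> (\<Union>k\<le>n. {x. (x, v) \<in> E ^^ k})" using x by auto
  qed
  then show ?thesis using fin by (auto intro: finite_subset)
qed

theorem theorem1p1:
  fixes E :: "('v \<times> 'v) set"
    and w :: "'v \<Rightarrow> 'v \<Rightarrow> real"
    and \<sigma> \<rho> :: "'v \<Rightarrow> real"
    and \<sigma>\<^sub>0 p \<alpha> :: real
    and v\<^sub>0 :: 'v
    and \<psi> :: "'v \<Rightarrow> real \<Rightarrow> real"
  assumes sym_E: "sym E"
    and connected_E: "\<forall>x y. (x, y) \<in> E\<^sup>*"
    and locally_finite: "\<forall>x. finite (E `` {x})"
    and weight: "\<forall>x y. (x, y) \<in> E \<longrightarrow> w x y = w y x \<and> w x y > 0"
    and measure: "\<sigma>\<^sub>0 > 0" "\<forall>x. \<sigma> x \<ge> \<sigma>\<^sub>0"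
    and p: "p > 1"
    and rho_nonneg: "\<forall>x. \<rho> x \<ge> 0"
    and rho_coercive: "filterlim \<rho> at_top (filtercomap (\<lambda>x. graph_dist E x v\<^sub>0) at_top)"
    and psi_zero: "\<forall>x. \<psi> x 0 = 0"
    and psi_cont: "\<forall>x. continuous_on {0..} (\<psi> x)"
    and psi_bound: "\<forall>M>0. \<exists>A. \<forall>x. \<forall>s\<in>{0..M}. \<psi> x s \<le> A"
    and psi_AR: "\<alpha> > p"
      "\<forall>x. \<forall>s>0. 0 < \<alpha> * integral {0..s} (\<psi> x) \<and> \<alpha> * integral {0..s} (\<psi> x) \<le> s * \<psi> x s"
    and psi_near_zero: "\<exists>\<tau> < lambda_p E w \<sigma> \<rho> p. \<exists>\<delta>>0. \<forall>x. \<forall>s. 0 < s \<and> s < \<delta> \<longrightarrow>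
      \<psi> x s \<le> \<tau> * s powr (p - 1)"
  shows "\<exists>u \<in> Hp_space E w \<sigma> \<rho> p.
    (\<forall>x. - p_laplacian E w \<sigma> p u x + \<rho> x * \<bar>u x\<bar> powr (p - 2) * u x = \<psi> x (max (u x) 0)) \<and>
    (\<forall>x. u x > 0)"
proof -
  obtain \<tau> \<delta> where \<tau>: "\<tau> < lambda_p E w \<sigma> \<rho> p" "\<delta> > 0"
      "\<And>x s. 0 < s \<Longrightarrow> s < \<delta> \<Longrightarrow> \<psi> x s \<le> \<tau> * s powr (p - 1)"
    using psi_near_zero by blast
  have sigma_pos: "\<sigma> x > 0" for x using measure by (meson less_le_trans)
  interpret weighted_graph E w \<sigma> \<rho> p
    by unfold_locales (use sym_E locally_finite weight sigma_pos p rho_nonneg in auto)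
  interpret superlinear_problem E w \<sigma> \<rho> p \<psi> \<alpha> \<sigma>\<^sub>0 "lambda_p E w \<sigma> \<rho> p" \<tau> \<delta>
    by unfold_locales
      (use measure psi_zero psi_cont psi_AR \<tau> in \<open>auto intro: lambda_p_le\<close>)
  define A where "A n = {x. graph_dist E x v\<^sub>0 \<le> n}" for n
  have A: "finite (A n)" for n
    unfolding A_def using sym_E locally_finite connected_E by (intro finite_graph_ball) auto
  have "\<exists>u\<in>Hp_space E w \<sigma> \<rho> p. (\<forall>x. L u x = \<psi> x (u x)) \<and> (\<forall>x. u x > 0)"
  proof (rule positive_solution[of A])
    show "finite (A n)" for n by (rule A)
    show "incseq A" by (auto simp: A_def incseq_def)
    show "(\<Union>n. A n) = UNIV" by (auto simp: A_def)
    show "(x, y) \<in> E\<^sup>*" for x y using connected_E by blast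
    show "finite {x. \<rho> x < Z}" for Z
    proof -
      have "\<forall>\<^sub>F x in filtercomap (\<lambda>x. graph_dist E x v\<^sub>0) at_top. Z \<le> \<rho> x"
        using rho_coercive by (auto simp: filterlim_at_top)
      then obtain N where N: "\<And>x. N \<le> graph_dist E x v\<^sub>0 \<Longrightarrow> Z \<le> \<rho> x"
        by (auto simp: eventually_filtercomap eventually_at_top_linorder)
      have "{x. \<rho> x < Z} \<subseteq> A N"
        using N by (force simp: A_def not_le[symmetric])
      then show ?thesis using A finite_subset by blast
    qed
  qed
  then obtain u where u: "u \<in> Hp_space E w \<sigma> \<rho> p" "\<And>x. L u x = \<psi> x (u x)" "\<And>x. u x > 0"
    by blast
  have "- p_laplacian E w \<sigma> p u x + \<rho> x * \<bar>u x\<bar> powr (p - 2) * u x = \<psi> x (max (u x) 0)" for x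
    using u(2)[of x] u(3)[of x] by (simp add: L_def max_def)
  then show ?thesis using u by blast
qed

end
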